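(* Let $\Omega\subset\mathbb{R}^p$ be open, connected and bounded with smooth boundary, let $L\in\mathcal{G}_\tau((\bar\Omega\times\mathbb{R}^q)^{(n)})$ and $\mathcal{L}(u)=\int_\Omega L(x,u^{(n)}(x))\,dx$ for $u\in\mathcal{G}(\bar\Omega)^q$. Suppose that the total second order derivative of $L$ with respect to the variables $u^{(n)}$ is globally bounded, independently of $\varepsilon$ (i.e. $L$ has a representative $(L_\varepsilon)_\varepsilon$ for which $|D^2_{u^{(n)}}L_\varepsilon|\le C$ on the whole jet space with $C$ independent of $\varepsilon$). If $u\in\mathcal{G}(\bar\Omega)^q$ is a minimizer of $\mathcal{L}$ in the sense of association, then $u$ satisfies the Euler–Lagrange equations for $\mathcal{L}$ in the sense of association: $E_\alpha(L)\approx0$ for $\alpha=1,\dots,q$, i.e. $$\lim_{\varepsilon\to0}\int_\Omega E_\alpha(L_\varepsilon)(u_\varepsilon)(x)\,\varphi(x)\,dx=0\qquad\forall\varphi\in\mathcal{D}(\Omega),\ \forall\alpha.$$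
   Context: Colombeau algebras. $\mathcal{G}(\bar\Omega)=\mathcal{E}_M(\bar\Omega)/\mathcal{N}(\bar\Omega)$, where $\mathcal{E}_M(\bar\Omega)$ is the set of nets $(u_\varepsilon)_{\varepsilon\in(0,1]}$ in $C^\infty(\bar\Omega)$ (functions smooth in $\Omega$ all of whose derivatives extend continuously to $\bar\Omega$) such that for every multi-index $\alpha$ there is $N\in\mathbb{N}$ with $\sup_{\bar\Omega}|\partial^\alpha u_\varepsilon|=O(\varepsilon^{-N})$ as $\varepsilon\to0$, and $\mathcal{N}(\bar\Omega)$ is the set of nets with $\sup_{\bar\Omega}|\partial^\alpha u_\varepsilon|=O(\varepsilon^m)$ for all $\alpha,m$. Jets. $(\bar\Omega\times\mathbb{R}^q)^{(n)}=\bar\Omega\times\mathbb{R}^d$ is the $n$-jet space, with coordinates $x$ and $u^\alpha_J$, $J=(j_1,\dots,j_k)$ unordered, $1\le j_i\le p$, $0\le k\le n$ ($u^\alpha_\emptyset=u^\alpha$); the variables $u^{(n)}$ are all the $u^\alpha_J$. For a function $u$, $u^{(n)}(x)$ denotes the values of $u$ and its partial derivatives up to order $n$. $D_i$ is the $i$-th total derivative, $(-D)_J=(-1)^kD_{j_1}\cdots D_{j_k}$, and the Euler operators are $E_\alpha=\sum_J(-D)_J\frac{\partial}{\partial u^\alpha_J}$ (sum over unordered $J$, $0\le k\le n$). $E_\alpha(L_\varepsilon)(u_\varepsilon)(x)$ is $E_\alpha(L_\varepsilon)$ evaluated along $u_\varepsilon$ and its derivatives at $x$. Tempered algebra. $\mathcal{G}_\tau((\bar\Omega\times\mathbb{R}^q)^{(n)})$: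 nets of smooth functions $L_\varepsilon$ on the jet space such that for each $\beta$ there is $N$ with $\sup_z(1+|z|)^{-N}|\partial^\beta L_\varepsilon(z)|=O(\varepsilon^{-N})$, modulo nets such that for each $\beta$ there is $l$ such that for all $m$, $\sup_z(1+|z|)^{-l}|\partial^\beta L_\varepsilon(z)|=O(\varepsilon^m)$. Write $\mathcal{L}_\varepsilon(u)=\int_\Omega L_\varepsilon(x,u^{(n)}(x))\,dx$ for $u\in C^\infty(\bar\Omega)^q$. An element $u$ is a minimizer of $\mathcal{L}$ in the sense of association if for any (hence all) representatives $(L_\varepsilon)_\varepsilon$ of $L$ and $(u_\varepsilon)_\varepsilon$ of $u$, $$\lim_{\varepsilon\to0}\big(\mathcal{L}_\varepsilon(u_\varepsilon+\varphi)-\mathcal{L}_\varepsilon(u_\varepsilon)\big)\ge0\qquad\forall\varphi\in\mathcal{D}(\Omega)^q$$ (the limit being understood to exist). $\mathcal{D}(\Omega)$ is the space of smooth compactly supported functions on $\Omega$. *)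

theory Defs
  imports "HOL-Analysis.Analysis" "HOL-Library.Multiset"
begin

section \<open>Iterated partial derivatives and smoothness up to the boundary\<close>

text \<open>
  Functions on \<open>\<real>\<^sup>p\<close> and functions on jet space are treated alike. A space with coordinates
  indexed by \<open>'c\<close> is described by a map \<open>sh\<close>, where \<open>sh c t z\<close> is the point \<open>z\<close> with \<open>t\<close> added to
  its coordinate \<open>c\<close>.
\<close>

definition pd :: "('c \<Rightarrow> real \<Rightarrow> 'z \<Rightarrow> 'z) \<Rightarrow> 'c \<Rightarrow> ('z \<Rightarrow> real) \<Rightarrow> 'z \<Rightarrow> real" where
  "pd sh c f z = deriv (\<lambda>t. f (sh c t z)) 0"

fun pds :: "('c \<Rightarrow> real \<Rightarrow> 'z \<Rightarrow> 'z) \<Rightarrow> 'c list \<Rightarrow> ('z \<Rightarrow> real) \<Rightarrow> 'z \<Rightarrow> real" where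
  "pds sh [] f = f"
| "pds sh (c # cs) f = pd sh c (pds sh cs f)"

text \<open>\<open>C\<^sup>\<infinity>(S)\<close> for open \<open>S\<close>, with respect to the coordinates in \<open>C\<close>: all iterated partial
  derivatives exist and are continuous.\<close>

definition smooth_on ::
  "('c \<Rightarrow> real \<Rightarrow> 'z \<Rightarrow> 'z) \<Rightarrow> 'c set \<Rightarrow> 'z set \<Rightarrow> ('z::topological_space \<Rightarrow> real) \<Rightarrow> bool" where
  "smooth_on sh C S f \<longleftrightarrow>
     (\<forall>cs. set cs \<subseteq> C \<longrightarrow>
        continuous_on S (pds sh cs f) \<and>
        (\<forall>c\<in>C. \<forall>z\<in>S. (\<lambda>t. pds sh cs f (sh c t z)) differentiable (at 0)))"

text \<open>Smooth in \<open>S\<close>, with all derivatives extending continuously to the closure of \<open>S\<close>; the values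
  of \<open>f\<close> itself on the closure are those of its continuous extension.\<close>

definition smooth_cl ::
  "('c \<Rightarrow> real \<Rightarrow> 'z \<Rightarrow> 'z) \<Rightarrow> 'c set \<Rightarrow> 'z set \<Rightarrow> ('z::topological_space \<Rightarrow> real) \<Rightarrow> bool" where
  "smooth_cl sh C S f \<longleftrightarrow>
     smooth_on sh C S f \<and> continuous_on (closure S) f \<and>
     (\<forall>cs. set cs \<subseteq> C \<longrightarrow>
        (\<exists>g. continuous_on (closure S) g \<and> (\<forall>z\<in>S. g z = pds sh cs f z)))"

text \<open>The continuous extension to the closure of the derivative along \<open>cs\<close>.\<close>

definition pds_cl ::
  "('c \<Rightarrow> real \<Rightarrow> 'z \<Rightarrow> 'z) \<Rightarrow> 'z set \<Rightarrow> 'c list \<Rightarrow> ('z \<Rightarrow> real) \<Rightarrow> 'z::topological_space \<Rightarrow> real" where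
  "pds_cl sh S cs f z = (if z \<in> S then pds sh cs f z else Lim (at z within S) (pds sh cs f))"

text \<open>\<open>sup\<^sub>A |f\<^sub>\<epsilon>| = O(g(\<epsilon>))\<close> as \<open>\<epsilon> \<rightarrow> 0\<close>, spelled out pointwise because the real-valued
  supremum of an unbounded set is unspecified.\<close>

definition sup_bigo :: "'z set \<Rightarrow> (real \<Rightarrow> 'z \<Rightarrow> real) \<Rightarrow> (real \<Rightarrow> real) \<Rightarrow> bool" where
  "sup_bigo A f g \<longleftrightarrow> (\<exists>K. \<forall>\<^sub>F \<epsilon> in at_right 0. \<forall>z\<in>A. \<bar>f \<epsilon> z\<bar> \<le> K * g \<epsilon>)"


section \<open>The Colombeau algebra on the closure of a domain\<close>

definition xshift :: "'p \<Rightarrow> real \<Rightarrow> real ^ 'p \<Rightarrow> real ^ 'p" where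
  "xshift i t x = x + t *\<^sub>R axis i 1"

text \<open>Only the values of a net at \<open>\<epsilon> \<in> (0,1]\<close> matter.\<close>

type_synonym 'p net = "real \<Rightarrow> real ^ 'p \<Rightarrow> real"

definition nets :: "(real ^ 'p) set \<Rightarrow> 'p net set" where
  "nets \<Omega> = {u. \<forall>\<epsilon>\<in>{0<..1}. smooth_cl xshift UNIV \<Omega> (u \<epsilon>)}"

definition moderate :: "(real ^ 'p) set \<Rightarrow> 'p net set" where
  "moderate \<Omega> = {u \<in> nets \<Omega>.
     \<forall>a. \<exists>N::nat. sup_bigo (closure \<Omega>) (\<lambda>\<epsilon>. pds_cl xshift \<Omega> a (u \<epsilon>)) (\<lambda>\<epsilon>. (1 / \<epsilon>) ^ N)}"

definition negligible_nets :: "(real ^ 'p) set \<Rightarrow> 'p net set" where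
  "negligible_nets \<Omega> = {u \<in> nets \<Omega>.
     \<forall>a. \<forall>m::nat. sup_bigo (closure \<Omega>) (\<lambda>\<epsilon>. pds_cl xshift \<Omega> a (u \<epsilon>)) (\<lambda>\<epsilon>. \<epsilon> ^ m)}"

definition colombeau :: "(real ^ 'p) set \<Rightarrow> 'p net set set" where
  "colombeau \<Omega> = moderate \<Omega> //
     {(u, v). u \<in> moderate \<Omega> \<and> v \<in> moderate \<Omega> \<and> (\<lambda>\<epsilon> x. u \<epsilon> x - v \<epsilon> x) \<in> negligible_nets \<Omega>}"

definition test_functions :: "(real ^ 'p) set \<Rightarrow> (real ^ 'p \<Rightarrow> real) set" where
  "test_functions \<Omega> =
     {\<phi>. smooth_on xshift UNIV UNIV \<phi> \<and> compact (closure {x. \<phi> x \<noteq> 0}) \<and> closure {x. \<phi> x \<noteq> 0} \<subseteq> \<Omega>}"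

text \<open>Smooth boundary, by local defining functions: near each boundary point, \<open>\<Omega>\<close> is a strict
  sublevel set of a smooth function without critical points.\<close>

definition smooth_boundary :: "(real ^ 'p) set \<Rightarrow> bool" where
  "smooth_boundary \<Omega> \<longleftrightarrow>
     (\<forall>x0\<in>frontier \<Omega>. \<exists>V \<psi>. open V \<and> x0 \<in> V \<and> smooth_on xshift UNIV V \<psi> \<and>
        (\<forall>x\<in>V. \<exists>i. pd xshift i \<psi> x \<noteq> 0) \<and>
        \<Omega> \<inter> V = {x\<in>V. \<psi> x < 0} \<and> frontier \<Omega> \<inter> V = {x\<in>V. \<psi> x = 0})"


section \<open>Jets\<close>

text \<open>
  Unordered multi-indices \<open>J\<close> are multisets. A point of jet space carries the coordinates
  \<open>u\<^sup>\<alpha>\<^sub>J\<close> of all orders, and the functions on the \<open>n\<close>-jet space are the functions that depend only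
  on the coordinates of order at most \<open>n\<close> (predicate \<open>on_jets\<close>). Thus all the jet spaces
  live on one type, and total derivatives, which raise the order, are maps of functions on it.
  For such functions, continuity in the product topology used here is continuity in the finitely
  many coordinates of order at most \<open>n\<close>.
\<close>

type_synonym ('p, 'q) jet = "(real ^ 'p) \<times> ('q \<times> 'p multiset \<Rightarrow> real)"

datatype ('p, 'q) jcoord = X 'p | U "'q \<times> 'p multiset"

fun jshift :: "('p, 'q) jcoord \<Rightarrow> real \<Rightarrow> ('p::finite, 'q) jet \<Rightarrow> ('p::finite, 'q) jet" where
  "jshift (X i) t (x, v) = (xshift i t x, v)"
| "jshift (U a) t (x, v) = (x, v(a := v a + t))"

definition jidx :: "nat \<Rightarrow> ('q \<times> 'p multiset) set" where
  "jidx n = {(\<alpha>, J). size J \<le> n}"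

definition jcoords :: "nat \<Rightarrow> ('p, 'q) jcoord set" where
  "jcoords n = range X \<union> U ` jidx n"

definition on_jets :: "nat \<Rightarrow> (('p::finite, 'q) jet \<Rightarrow> real) \<Rightarrow> bool" where
  "on_jets n F \<longleftrightarrow> (\<forall>x v w. (\<forall>a\<in>jidx n. v a = w a) \<longrightarrow> F (x, v) = F (x, w))"

definition jnorm :: "nat \<Rightarrow> ('p::finite, 'q) jet \<Rightarrow> real" where
  "jnorm n z = sqrt ((norm (fst z))\<^sup>2 + (\<Sum>a\<in>jidx n. (snd z a)\<^sup>2))"

lemma finite_jidx: "finite (jidx n :: ('q::finite \<times> 'p::finite multiset) set)"
proof -
  have "{J :: 'p multiset. size J \<le> n} \<subseteq> mset ` {js. set js \<subseteq> UNIV \<and> length js \<le> n}"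
  proof
    fix J :: "'p multiset" assume "J \<in> {J. size J \<le> n}"
    moreover obtain js where "mset js = J" by (metis ex_mset)
    ultimately show "J \<in> mset ` {js. set js \<subseteq> UNIV \<and> length js \<le> n}" by auto
  qed
  moreover have "finite {js :: 'p list. set js \<subseteq> UNIV \<and> length js \<le> n}"
    by (rule finite_lists_length_le) simp
  ultimately have "finite {J :: 'p multiset. size J \<le> n}"
    by (meson finite_imageI finite_subset)
  then have "finite ((UNIV :: 'q set) \<times> {J :: 'p multiset. size J \<le> n})" by simp
  moreover have "jidx n = (UNIV :: 'q set) \<times> {J :: 'p multiset. size J \<le> n}"
    by (auto simp: jidx_def)
  ultimately show ?thesis by simp
qed

text \<open>An enumeration of an unordered multi-index. Partial derivatives of smooth functions commute,
  and so do total derivatives, so that the choice of the order is immaterial.\<close>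

definition ordering :: "'p multiset \<Rightarrow> 'p list" where
  "ordering J = (SOME js. mset js = J)"

lemma mset_ordering: "mset (ordering J) = J"
  unfolding ordering_def by (rule someI_ex) (rule ex_mset)

text \<open>The point \<open>(x, u\<^sup>(\<^sup>n\<^sup>)(x))\<close>, for all \<open>n\<close> at once.\<close>

definition jet :: "('q \<Rightarrow> real ^ 'p \<Rightarrow> real) \<Rightarrow> real ^ 'p \<Rightarrow> ('p::finite, 'q) jet" where
  "jet u x = (x, \<lambda>(\<alpha>, J). pds xshift (ordering J) (u \<alpha>) x)"

text \<open>\<open>D\<^sub>i\<close> on functions on the \<open>k\<close>-jet space, with values in functions on the \<open>(k+1)\<close>-jet space.\<close>

definition total_deriv :: "nat \<Rightarrow> 'p \<Rightarrow> (('p::finite, 'q) jet \<Rightarrow> real) \<Rightarrow> ('p::finite, 'q) jet \<Rightarrow> real" where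
  "total_deriv k i F z =
     pd jshift (X i) F z +
     (\<Sum>(\<alpha>, J)\<in>jidx k. snd z (\<alpha>, add_mset i J) * pd jshift (U (\<alpha>, J)) F z)"

fun total_derivs :: "nat \<Rightarrow> 'p list \<Rightarrow> (('p::finite, 'q) jet \<Rightarrow> real) \<Rightarrow> ('p::finite, 'q) jet \<Rightarrow> real" where
  "total_derivs k [] F = F"
| "total_derivs k (j # js) F = total_deriv (k + length js) j (total_derivs k js F)"

definition euler :: "nat \<Rightarrow> 'q \<Rightarrow> (('p::finite, 'q) jet \<Rightarrow> real) \<Rightarrow> ('p::finite, 'q) jet \<Rightarrow> real" where
  "euler n \<alpha> F z =
     (\<Sum>J | size J \<le> n. (-1) ^ size J * total_derivs n (ordering J) (pd jshift (U (\<alpha>, J)) F) z)"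


section \<open>The tempered algebra\<close>

type_synonym ('p, 'q) jnet = "real \<Rightarrow> ('p, 'q) jet \<Rightarrow> real"

definition jet_nets :: "nat \<Rightarrow> (real ^ 'p) set \<Rightarrow> ('p, 'q) jnet set" where
  "jet_nets n \<Omega> = {L. \<forall>\<epsilon>\<in>{0<..1}.
     on_jets n (L \<epsilon>) \<and> smooth_cl jshift (jcoords n) (\<Omega> \<times> UNIV) (L \<epsilon>)}"

definition tempered_moderate :: "nat \<Rightarrow> (real ^ 'p) set \<Rightarrow> ('p, 'q) jnet set" where
  "tempered_moderate n \<Omega> = {L \<in> jet_nets n \<Omega>.
     \<forall>b. set b \<subseteq> jcoords n \<longrightarrow> (\<exists>N::nat.
       sup_bigo (closure \<Omega> \<times> UNIV)
         (\<lambda>\<epsilon> z. pds_cl jshift (\<Omega> \<times> UNIV) b (L \<epsilon>) z / (1 + jnorm n z) ^ N) (\<lambda>\<epsilon>. (1 / \<epsilon>) ^ N))}"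

definition tempered_negligible :: "nat \<Rightarrow> (real ^ 'p) set \<Rightarrow> ('p, 'q) jnet set" where
  "tempered_negligible n \<Omega> = {L \<in> jet_nets n \<Omega>.
     \<forall>b. set b \<subseteq> jcoords n \<longrightarrow> (\<exists>l::nat. \<forall>m::nat.
       sup_bigo (closure \<Omega> \<times> UNIV)
         (\<lambda>\<epsilon> z. pds_cl jshift (\<Omega> \<times> UNIV) b (L \<epsilon>) z / (1 + jnorm n z) ^ l) (\<lambda>\<epsilon>. \<epsilon> ^ m))}"

definition tempered :: "nat \<Rightarrow> (real ^ 'p) set \<Rightarrow> ('p, 'q) jnet set set" where
  "tempered n \<Omega> = tempered_moderate n \<Omega> //
     {(L, M). L \<in> tempered_moderate n \<Omega> \<and> M \<in> tempered_moderate n \<Omega> \<and>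
        (\<lambda>\<epsilon> z. L \<epsilon> z - M \<epsilon> z) \<in> tempered_negligible n \<Omega>}"

text \<open>\<open>|D\<^sup>2F|\<close>, the derivative being taken with respect to the variables \<open>u\<^sup>(\<^sup>n\<^sup>)\<close> only
  (Hilbert--Schmidt norm of the Hessian).\<close>

definition hessian_norm ::
  "nat \<Rightarrow> (real ^ 'p) set \<Rightarrow> (('p::finite, 'q) jet \<Rightarrow> real) \<Rightarrow> ('p::finite, 'q) jet \<Rightarrow> real" where
  "hessian_norm n \<Omega> F z =
     sqrt (\<Sum>a\<in>jidx n. \<Sum>b\<in>jidx n. (pds_cl jshift (\<Omega> \<times> UNIV) [U a, U b] F z)\<^sup>2)"


section \<open>Minimizers in the sense of association\<close>

definition functional ::
  "(real ^ 'p) set \<Rightarrow> (('p::finite, 'q) jet \<Rightarrow> real) \<Rightarrow> ('q \<Rightarrow> real ^ 'p \<Rightarrow> real) \<Rightarrow> real" where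
  "functional \<Omega> F u = (LINT x:\<Omega>|lborel. F (jet u x))"

text \<open>Representatives are quantified existentially, as the condition does not depend on them.\<close>

definition minimizer_assoc ::
  "(real ^ 'p) set \<Rightarrow> ('p, 'q) jnet set \<Rightarrow> ('q \<Rightarrow> 'p net set) \<Rightarrow> bool" where
  "minimizer_assoc \<Omega> L u \<longleftrightarrow>
     (\<exists>L'\<in>L. \<exists>u'. (\<forall>\<alpha>. u' \<alpha> \<in> u \<alpha>) \<and>
        (\<forall>\<phi>. (\<forall>\<alpha>. \<phi> \<alpha> \<in> test_functions \<Omega>) \<longrightarrow>
           (\<exists>l\<ge>0. ((\<lambda>\<epsilon>. functional \<Omega> (L' \<epsilon>) (\<lambda>\<alpha> x. u' \<alpha> \<epsilon> x + \<phi> \<alpha> x) -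
                         functional \<Omega> (L' \<epsilon>) (\<lambda>\<alpha>. u' \<alpha> \<epsilon>)) \<longlongrightarrow> l) (at_right 0))))"

end

theory Submission
  imports Defs
begin

text \<open>
  Let \<open>I\<^sub>\<epsilon>(\<phi>) = \<integral> \<Sum> \<partial>L\<^sub>\<epsilon>/\<partial>u\<^sub>J (u\<^sub>\<epsilon>) \<cdot> \<partial>\<^sup>J\<phi>\<close> be the first variation in the component \<open>\<alpha>\<close>. The proof
  rests on three observations.

  Integrating by parts, \<open>\<integral> E\<^sub>\<alpha>(L\<^sub>\<epsilon>)(u\<^sub>\<epsilon>) \<phi> = I\<^sub>\<epsilon>(\<phi>)\<close> for each fixed \<open>\<epsilon>\<close> (\<open>integral_euler\<close>). There are no
  boundary terms because the test function has compact support. The ingredients are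
  that the total derivative of \<open>F\<close> evaluated along a jet is the partial derivative of
  \<open>x \<mapsto> F(x, u\<^sup>(\<^sup>n\<^sup>)(x))\<close> (\<open>has_pd_along_jet\<close>) and that the integral of a partial derivative of a compactly
  supported function vanishes.

  If the Hessian of \<open>L\<^sub>\<epsilon>\<close> is bounded by \<open>C\<close>, then
  \<open>|\<L>\<^sub>\<epsilon>(u\<^sub>\<epsilon> + t\<phi>) - \<L>\<^sub>\<epsilon>(u\<^sub>\<epsilon>) - t I\<^sub>\<epsilon>(\<phi>)| \<le> M t\<^sup>2\<close> with \<open>M\<close> independent of \<open>\<epsilon>\<close>
  (\<open>functional_increment_estimate\<close>). For fixed \<open>t\<close> the increment tends to a nonnegative limit, hence
  \<open>t I\<^sub>\<epsilon>(\<phi>) \<ge> -(M + 1) t\<^sup>2\<close> for all small \<open>\<epsilon>\<close>. Taking \<open>t\<close> small and of either sign gives \<open>I\<^sub>\<epsilon>(\<phi>) \<rightarrow> 0\<close>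
  (\<open>first_order_condition\<close>).

  The bound on the Hessian, the minimizing property and the conclusion refer to representatives that may
  all differ. Changing the representative of \<open>L\<close> changes its value and its first derivatives along moderate jets by
  negligible amounts. Changing the representative of \<open>u\<close> in the first variation is harmless for the
  Lagrangian with bounded Hessian, whose first derivatives are Lipschitz uniformly in \<open>\<epsilon>\<close>
  (\<open>functional_independent_of_representative\<close>, \<open>first_variation_independent_of_representatives\<close>).
\<close>

section \<open>Smooth functions on a space with coordinates\<close>

text \<open>The shifts along the coordinates are flows that do not leave the open set \<open>S\<close> at once. This
  is all that Euclidean space and jet space need to share.\<close>

locale coordinate_space =
  fixes sh :: "'c \<Rightarrow> real \<Rightarrow> 'z::topological_space \<Rightarrow> 'z" and C :: "'c set" and S :: "'z set"
  assumes shift_zero: "sh c 0 z = z"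
    and shift_add: "sh c (s + t) z = sh c s (sh c t z)"
    and shift_stays: "c \<in> C \<Longrightarrow> z \<in> S \<Longrightarrow> \<forall>\<^sub>F t in nhds 0. sh c t z \<in> S"

lemma pds_append: "pds sh (as @ bs) f = pds sh as (pds sh bs f)"
  by (induction as) auto

lemma pd_eqI:
  "((\<lambda>t. f (sh c t z)) has_real_derivative d) (at 0) \<Longrightarrow> pd sh c f z = d"
  unfolding pd_def by (rule DERIV_imp_deriv)

lemma smooth_on_continuous: "smooth_on sh C S f \<Longrightarrow> continuous_on S f"
  unfolding smooth_on_def by (drule spec[of _ "[]"]) simp

lemma smooth_on_has_pd:
  "smooth_on sh C S f \<Longrightarrow> c \<in> C \<Longrightarrow> z \<in> S \<Longrightarrow>
    ((\<lambda>t. f (sh c t z)) has_real_derivative pd sh c f z) (at 0)"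
  unfolding smooth_on_def pd_def DERIV_deriv_iff_real_differentiable
  by (drule spec[of _ "[]"]) simp

lemma smooth_on_pds:
  assumes "smooth_on sh C S f" "set as \<subseteq> C" shows "smooth_on sh C S (pds sh as f)"
  unfolding smooth_on_def pds_append[symmetric]
  using assms unfolding smooth_on_def by auto

lemma smooth_on_pd:
  "smooth_on sh C S f \<Longrightarrow> c \<in> C \<Longrightarrow> smooth_on sh C S (pd sh c f)"
  using smooth_on_pds[of sh C S f "[c]"] by simp

text \<open>An auxiliary class: the generated algebra is visibly closed under partial derivatives by the
  Leibniz rule, whereas for products of smooth functions alone this would require formulas for
  iterated derivatives.\<close>

inductive smooth_algebra ::
  "('c \<Rightarrow> real \<Rightarrow> 'z \<Rightarrow> 'z) \<Rightarrow> 'c set \<Rightarrow> 'z set \<Rightarrow> ('z::topological_space \<Rightarrow> real) \<Rightarrow> bool"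
  for sh C S where
  smooth: "smooth_on sh C S f \<Longrightarrow> smooth_algebra sh C S f"
| add: "smooth_algebra sh C S f \<Longrightarrow> smooth_algebra sh C S g \<Longrightarrow>
    smooth_algebra sh C S (\<lambda>z. f z + g z)"
| mult: "smooth_algebra sh C S f \<Longrightarrow> smooth_algebra sh C S g \<Longrightarrow>
    smooth_algebra sh C S (\<lambda>z. f z * g z)"

context coordinate_space
begin

lemma has_pd_cong:
  assumes "c \<in> C" "z \<in> S" "\<And>y. y \<in> S \<Longrightarrow> f y = g y"
    and "((\<lambda>t. f (sh c t z)) has_real_derivative d) (at 0)"
  shows "((\<lambda>t. g (sh c t z)) has_real_derivative d) (at 0)"
proof -
  have "\<forall>\<^sub>F t in nhds 0. f (sh c t z) = g (sh c t z)"
    using shift_stays[OF assms(1,2)] by eventually_elim (rule assms(3))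
  then show ?thesis
    using assms(4) DERIV_cong_ev[OF refl _ refl] by fastforce
qed

lemma pd_cong:
  assumes "c \<in> C" "z \<in> S" "\<And>y. y \<in> S \<Longrightarrow> f y = g y"
  shows "pd sh c f z = pd sh c g z"
proof -
  have "\<forall>\<^sub>F t in nhds 0. f (sh c t z) = g (sh c t z)"
    using shift_stays[OF assms(1,2)] by eventually_elim (rule assms(3))
  then show ?thesis
    unfolding pd_def by (rule deriv_cong_ev) simp
qed

text \<open>At times other than \<open>0\<close> the derivative along a coordinate line is obtained by restarting the
  flow.\<close>

lemma has_pd_along:
  assumes "smooth_on sh C S f" "c \<in> C" "sh c t z \<in> S"
  shows "((\<lambda>r. f (sh c r z)) has_real_derivative pd sh c f (sh c t z)) (at t)"
proof -
  have "((\<lambda>r. f (sh c (r + t) z)) has_real_derivative pd sh c f (sh c t z)) (at 0)"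
    using smooth_on_has_pd[OF assms] by (simp add: shift_add)
  then show ?thesis
    using DERIV_shift[of "\<lambda>r. f (sh c r z)" _ 0 t] by simp
qed

text \<open>Smoothness is a greatest fixed point: it suffices to exhibit a class of continuous functions
  that is closed under partial derivatives.\<close>

lemma smooth_on_coinduct:
  assumes "P f"
    and cont: "\<And>f. P f \<Longrightarrow> continuous_on S f"
    and step: "\<And>f c. P f \<Longrightarrow> c \<in> C \<Longrightarrow>
      \<exists>g. P g \<and> (\<forall>z\<in>S. ((\<lambda>t. f (sh c t z)) has_real_derivative g z) (at 0))"
  shows "smooth_on sh C S f"
proof -
  have *: "\<exists>g. P g \<and> (\<forall>z\<in>S. pds sh cs f z = g z)" if "set cs \<subseteq> C" for cs
    using that
  proof (induction cs)
    case (Cons c cs)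
    then obtain g where g: "P g" "\<forall>z\<in>S. pds sh cs f z = g z" by auto
    obtain h where h: "P h" "\<forall>z\<in>S. ((\<lambda>t. g (sh c t z)) has_real_derivative h z) (at 0)"
      using step[OF g(1), of c] Cons.prems by auto
    have "pds sh (c # cs) f z = h z" if "z \<in> S" for z
    proof -
      have "pd sh c (pds sh cs f) z = pd sh c g z"
        using Cons.prems g(2) that by (intro pd_cong) auto
      then show ?thesis using h(2) that by (auto dest: pd_eqI)
    qed
    with h(1) show ?case by blast
  qed (use assms(1) in auto)
  show ?thesis
    unfolding smooth_on_def
  proof (intro allI impI conjI ballI)
    fix cs assume cs: "set cs \<subseteq> C"
    then obtain g where g: "P g" "\<forall>z\<in>S. pds sh cs f z = g z" using * by blast
    show "continuous_on S (pds sh cs f)"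
      using continuous_on_cong[OF refl, of S "pds sh cs f" g] cont[OF g(1)] g(2) by simp
    fix c z assume c: "c \<in> C" "z \<in> S"
    obtain h where h: "\<forall>z\<in>S. ((\<lambda>t. g (sh c t z)) has_real_derivative h z) (at 0)"
      using step[OF g(1) c(1)] by blast
    have "((\<lambda>t. pds sh cs f (sh c t z)) has_real_derivative h z) (at 0)"
      by (rule has_pd_cong[of c z g]) (use c g h in auto)
    then show "(\<lambda>t. pds sh cs f (sh c t z)) differentiable (at 0)"
      using real_differentiable_def by blast
  qed
qed

lemma smooth_algebra_imp_smooth_on:
  assumes "smooth_algebra sh C S f" shows "smooth_on sh C S f"
proof (rule smooth_on_coinduct[where P = "smooth_algebra sh C S"])
  show "continuous_on S f" if "smooth_algebra sh C S f" for f
    using that by induction (auto intro: smooth_on_continuous continuous_intros)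
  show "\<exists>g. smooth_algebra sh C S g \<and> (\<forall>z\<in>S. ((\<lambda>t. f (sh c t z)) has_real_derivative g z) (at 0))"
    if "smooth_algebra sh C S f" "c \<in> C" for f c
    using that(1)
  proof induction
    case (smooth f)
    then show ?case
      using smooth_on_has_pd smooth_on_pd that(2) smooth_algebra.smooth by metis
  next
    case (add f g)
    then obtain f' g' where f': "smooth_algebra sh C S f'"
        "\<forall>z\<in>S. ((\<lambda>t. f (sh c t z)) has_real_derivative f' z) (at 0)"
      and g': "smooth_algebra sh C S g'"
        "\<forall>z\<in>S. ((\<lambda>t. g (sh c t z)) has_real_derivative g' z) (at 0)" by blast
    then show ?case
      by (intro exI[of _ "\<lambda>z. f' z + g' z"]) (auto intro: smooth_algebra.add DERIV_add)
  next
    case (mult f g)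
    then obtain f' g' where f': "smooth_algebra sh C S f'"
        "\<forall>z\<in>S. ((\<lambda>t. f (sh c t z)) has_real_derivative f' z) (at 0)"
      and g': "smooth_algebra sh C S g'"
        "\<forall>z\<in>S. ((\<lambda>t. g (sh c t z)) has_real_derivative g' z) (at 0)" by blast
    have "((\<lambda>t. f (sh c t z) * g (sh c t z)) has_real_derivative f' z * g z + g' z * f z) (at 0)"
      if "z \<in> S" for z
      using DERIV_mult[OF bspec[OF f'(2) that] bspec[OF g'(2) that]] by (simp add: shift_zero)
    then show ?case
      using f' g' mult.hyps
      by (intro exI[of _ "\<lambda>z. f' z * g z + g' z * f z"])
        (auto intro!: smooth_algebra.add smooth_algebra.mult)
  qed
qed (fact assms)

lemma smooth_on_add:
  "smooth_on sh C S f \<Longrightarrow> smooth_on sh C S g \<Longrightarrow> smooth_on sh C S (\<lambda>z. f z + g z)"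
  by (rule smooth_algebra_imp_smooth_on[OF smooth_algebra.add[OF smooth_algebra.smooth smooth_algebra.smooth]])

lemma smooth_on_mult:
  "smooth_on sh C S f \<Longrightarrow> smooth_on sh C S g \<Longrightarrow> smooth_on sh C S (\<lambda>z. f z * g z)"
  by (rule smooth_algebra_imp_smooth_on[OF smooth_algebra.mult[OF smooth_algebra.smooth smooth_algebra.smooth]])

lemma smooth_on_const: "smooth_on sh C S (\<lambda>z. k)"
  by (rule smooth_on_coinduct[where P = "\<lambda>f. \<exists>k. f = (\<lambda>z. k)"])
    (auto intro!: exI[of _ "\<lambda>_. 0::real"])

lemma smooth_on_sum:
  "(\<And>i. i \<in> I \<Longrightarrow> smooth_on sh C S (f i)) \<Longrightarrow> smooth_on sh C S (\<lambda>z. \<Sum>i\<in>I. f i z)"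
  by (induction I rule: infinite_finite_induct) (auto intro: smooth_on_add smooth_on_const)

text \<open>Linearity can fail elsewhere: off \<open>S\<close>, or for nonsmooth functions, \<open>deriv\<close> is an arbitrary
  value and need not be additive.\<close>

lemma pds_linear:
  assumes "smooth_on sh C S f" "smooth_on sh C S g" "set cs \<subseteq> C" "z \<in> S"
  shows "pds sh cs (\<lambda>z. a * f z + b * g z) z = a * pds sh cs f z + b * pds sh cs g z"
  using assms(3,4)
proof (induction cs arbitrary: z)
  case (Cons c cs)
  have "pd sh c (pds sh cs (\<lambda>z. a * f z + b * g z)) z =
    pd sh c (\<lambda>z. a * pds sh cs f z + b * pds sh cs g z) z"
    using Cons by (intro pd_cong) auto
  also have "\<dots> = a * pd sh c (pds sh cs f) z + b * pd sh c (pds sh cs g) z"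
    using Cons.prems assms(1,2)
    by (intro pd_eqI DERIV_add DERIV_cmult smooth_on_has_pd smooth_on_pds) auto
  finally show ?case by simp
qed simp

end

section \<open>Partial derivatives on Euclidean space\<close>

lemma coordinate_space_xshift:
  assumes "open (S :: (real ^ 'p::finite) set)" shows "coordinate_space xshift C S"
proof
  fix c :: 'p and s t z
  show "xshift c 0 z = z" "xshift c (s + t) z = xshift c s (xshift c t z)"
    by (auto simp: xshift_def algebra_simps)
  assume "z \<in> S"
  have "((\<lambda>t. xshift c t z) \<longlongrightarrow> xshift c 0 z) (nhds 0)"
    unfolding xshift_def by (intro tendsto_intros filterlim_ident)
  then show "\<forall>\<^sub>F t in nhds 0. xshift c t z \<in> S"
    using topological_tendstoD[OF _ assms] \<open>z \<in> S\<close> by (fastforce simp: xshift_def)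
qed

text \<open>Two applications of the mean value theorem express the second difference of \<open>f\<close> by one of
  the mixed derivatives. The second difference is symmetric in the two directions.\<close>

lemma second_difference_mean_value:
  fixes \<Omega> :: "(real ^ 'p::finite) set"
  assumes f: "smooth_on xshift UNIV \<Omega> f" and op: "open \<Omega>"
    and s: "s > 0" "cball x (2 * s) \<subseteq> \<Omega>"
  shows "\<exists>y\<in>cball x (2 * s).
    f (x + s *\<^sub>R axis i 1 + s *\<^sub>R axis j 1) - f (x + s *\<^sub>R axis i 1) - f (x + s *\<^sub>R axis j 1) + f x
      = s\<^sup>2 * pd xshift j (pd xshift i f) y"
proof -
  interpret coordinate_space xshift UNIV \<Omega> by (rule coordinate_space_xshift[OF op])
  have near: "x + a *\<^sub>R axis i 1 + b *\<^sub>R axis j 1 \<in> cball x (2 * s)"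
    if "\<bar>a\<bar> \<le> s" "\<bar>b\<bar> \<le> s" for a b
  proof -
    have "norm (a *\<^sub>R axis i 1 + b *\<^sub>R axis j 1 :: real ^ 'p) \<le> \<bar>a\<bar> + \<bar>b\<bar>"
      using norm_triangle_ineq[of "a *\<^sub>R axis i 1 :: real ^ 'p" "b *\<^sub>R axis j 1"] by simp
    moreover have "norm (x - (x + a *\<^sub>R axis i 1 + b *\<^sub>R axis j 1)) =
        norm (a *\<^sub>R axis i 1 + b *\<^sub>R axis j 1 :: real ^ 'p)"
      by (metis add.assoc add_diff_cancel_left' norm_minus_commute)
    ultimately show ?thesis using that by (simp add: dist_norm)
  qed
  have near0: "x + a *\<^sub>R axis i 1 \<in> \<Omega>" if "\<bar>a\<bar> \<le> s" for a
    using near[OF that, of 0] s by auto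
  define g where "g r = f (x + r *\<^sub>R axis i 1 + s *\<^sub>R axis j 1) - f (x + r *\<^sub>R axis i 1)" for r
  define g' where "g' r = pd xshift i f (x + r *\<^sub>R axis i 1 + s *\<^sub>R axis j 1)
    - pd xshift i f (x + r *\<^sub>R axis i 1)" for r
  have g: "(g has_real_derivative g' r) (at r)" if "0 \<le> r" "r \<le> s" for r
  proof -
    have 1: "((\<lambda>r. f (xshift i r (x + s *\<^sub>R axis j 1))) has_real_derivative
        pd xshift i f (xshift i r (x + s *\<^sub>R axis j 1))) (at r)"
      using near[of r s] that s
      by (intro has_pd_along[OF f]) (auto simp: xshift_def add_ac)
    have 2: "((\<lambda>r. f (xshift i r x)) has_real_derivative pd xshift i f (xshift i r x)) (at r)"
      using near0[of r] that s by (intro has_pd_along[OF f]) (auto simp: xshift_def)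
    show ?thesis
      using DERIV_diff[OF 1 2] unfolding g_def[abs_def] g'_def xshift_def by (simp add: add_ac)
  qed
  obtain r where r: "0 < r" "r < s" "g s - g 0 = s * g' r"
    using MVT2[OF s(1), of g g'] g by auto
  have "((\<lambda>q. pd xshift i f (x + r *\<^sub>R axis i 1 + q *\<^sub>R axis j 1)) has_real_derivative
      pd xshift j (pd xshift i f) (x + r *\<^sub>R axis i 1 + q *\<^sub>R axis j 1)) (at q)"
    if "0 \<le> q" "q \<le> s" for q
    using has_pd_along[OF smooth_on_pd[OF f UNIV_I, of i] UNIV_I, of j q "x + r *\<^sub>R axis i 1"]
      near[of r q] that s r by (auto simp: xshift_def)
  from MVT2[OF s(1) this] obtain q where q: "0 < q" "q < s"
    "g' r = s * pd xshift j (pd xshift i f) (x + r *\<^sub>R axis i 1 + q *\<^sub>R axis j 1)"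
    unfolding g'_def by auto
  show ?thesis
    using near[of r q] r q
    by (intro bexI[of _ "x + r *\<^sub>R axis i 1 + q *\<^sub>R axis j 1"])
      (auto simp: g_def power2_eq_square)
qed

text \<open>Both mixed derivatives are limits of the same second difference quotient, by continuity.\<close>

lemma pd_commute:
  fixes \<Omega> :: "(real ^ 'p::finite) set"
  assumes f: "smooth_on xshift UNIV \<Omega> f" and op: "open \<Omega>" and x: "x \<in> \<Omega>"
  shows "pd xshift i (pd xshift j f) x = pd xshift j (pd xshift i f) x"
proof -
  define F where "F i j = pd xshift j (pd xshift i f)" for i j
  have near: "\<exists>d>0. \<forall>y\<in>\<Omega>. dist y x < d \<longrightarrow> dist (F i j y) (F i j x) < e" if "e > 0" for i j e
    using smooth_on_continuous[OF smooth_on_pd[OF smooth_on_pd[OF f]]] x that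
    unfolding continuous_on_iff F_def by blast
  have "dist (F j i x) (F i j x) \<le> e" if e: "e > 0" for e
  proof -
    obtain d1 where d1: "d1 > 0" "\<And>y. y \<in> \<Omega> \<Longrightarrow> dist y x < d1 \<Longrightarrow> dist (F i j y) (F i j x) < e / 2"
      using near[of "e / 2"] e by (meson half_gt_zero)
    obtain d2 where d2: "d2 > 0" "\<And>y. y \<in> \<Omega> \<Longrightarrow> dist y x < d2 \<Longrightarrow> dist (F j i y) (F j i x) < e / 2"
      using near[of "e / 2"] e by (meson half_gt_zero)
    obtain d3 where d3: "d3 > 0" "cball x d3 \<subseteq> \<Omega>"
      using op x open_contains_cball by blast
    define s where "s = min d3 (min d1 d2) / 4"
    have s: "s > 0" "2 * s < d1" "2 * s < d2" "cball x (2 * s) \<subseteq> \<Omega>"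
      using d1 d2 d3 by (auto simp: s_def subset_iff)
    obtain y where y: "y \<in> cball x (2 * s)"
      "f (x + s *\<^sub>R axis i 1 + s *\<^sub>R axis j 1) - f (x + s *\<^sub>R axis i 1) - f (x + s *\<^sub>R axis j 1) + f x
        = s\<^sup>2 * F i j y"
      using second_difference_mean_value[OF f op s(1,4), of i j] unfolding F_def by blast
    obtain y' where y': "y' \<in> cball x (2 * s)"
      "f (x + s *\<^sub>R axis j 1 + s *\<^sub>R axis i 1) - f (x + s *\<^sub>R axis j 1) - f (x + s *\<^sub>R axis i 1) + f x
        = s\<^sup>2 * F j i y'"
      using second_difference_mean_value[OF f op s(1,4), of j i] unfolding F_def by blast
    have "s\<^sup>2 * F i j y = s\<^sup>2 * F j i y'"
    proof -
      have "x + s *\<^sub>R axis j 1 + s *\<^sub>R axis i 1 = x + s *\<^sub>R axis i 1 + s *\<^sub>R axis j 1"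
        by (simp add: add_ac)
      from y(2) y'(2)[unfolded this] show ?thesis by linarith
    qed
    then have "F i j y = F j i y'" using s by simp
    moreover have "dist (F i j y) (F i j x) < e / 2"
      using y(1) s by (intro d1) (auto simp: dist_commute)
    moreover have "dist (F j i y') (F j i x) < e / 2"
      using y'(1) s by (intro d2) (auto simp: dist_commute)
    ultimately show ?thesis by (smt (verit) dist_commute dist_triangle field_sum_of_halves)
  qed
  then have "dist (F j i x) (F i j x) \<le> 0"
    using field_le_epsilon[of "dist (F j i x) (F i j x)" 0] by simp
  then show ?thesis by (simp add: F_def)
qed

lemma pds_permute:
  fixes \<Omega> :: "(real ^ 'p::finite) set"
  assumes f: "smooth_on xshift UNIV \<Omega> f" and op: "open \<Omega>"
    and "mset as = mset bs" "x \<in> \<Omega>"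
  shows "pds xshift as f x = pds xshift bs f x"
  using assms(3,4)
proof (induction as arbitrary: bs x)
  case (Cons c as)
  interpret coordinate_space xshift UNIV \<Omega> by (rule coordinate_space_xshift[OF op])
  have "c \<in> set bs" using Cons.prems by (metis list.set_intros(1) mset_eq_setD)
  then obtain bs1 bs2 where bs: "bs = bs1 @ c # bs2" by (meson split_list)
  have move: "pds xshift (bs1 @ c # bs2) f x = pds xshift (c # bs1 @ bs2) f x" if "x \<in> \<Omega>" for x
    using that
  proof (induction bs1 arbitrary: x)
    case (Cons b bs1)
    have "pd xshift b (pds xshift (bs1 @ c # bs2) f) x = pd xshift b (pds xshift (c # bs1 @ bs2) f) x"
      using Cons by (intro pd_cong) auto
    also have "\<dots> = pd xshift b (pd xshift c (pds xshift (bs1 @ bs2) f)) x"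
      by simp
    also have "\<dots> = pd xshift c (pd xshift b (pds xshift (bs1 @ bs2) f)) x"
      using Cons.prems by (intro pd_commute[OF _ op] smooth_on_pds f) auto
    finally show ?case by simp
  qed simp
  have "pds xshift (c # as) f x = pd xshift c (pds xshift (bs1 @ bs2) f) x"
    using Cons bs by (auto intro!: pd_cong)
  then show ?case using move Cons.prems bs by simp
qed simp

section \<open>The chain rule on jet space\<close>

lemma coordinate_space_jshift:
  assumes "open (\<Omega> :: (real ^ 'p::finite) set)"
  shows "coordinate_space (jshift :: ('p, 'q) jcoord \<Rightarrow> _) C (\<Omega> \<times> UNIV)"
proof
  fix c :: "('p, 'q) jcoord" and s t and z :: "('p, 'q) jet"
  obtain x v where z: "z = (x, v)" by fastforce
  interpret x: coordinate_space xshift UNIV \<Omega> by (rule coordinate_space_xshift[OF assms])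
  show "jshift c 0 z = z" "jshift c (s + t) z = jshift c s (jshift c t z)"
    by (cases c; simp add: z x.shift_zero x.shift_add add_ac)+
  assume "z \<in> \<Omega> \<times> UNIV"
  then show "\<forall>\<^sub>F t in nhds 0. jshift c t z \<in> \<Omega> \<times> UNIV"
    using x.shift_stays[of _ x] by (cases c) (auto simp: z)
qed

lemma on_jets_pd:
  fixes F :: "('p::finite, 'q) jet \<Rightarrow> real"
  assumes "on_jets n F" shows "on_jets n (pd jshift c F)"
  unfolding on_jets_def
proof (intro allI impI)
  fix x and v w :: "'q \<times> 'p multiset \<Rightarrow> real" assume vw: "\<forall>a\<in>jidx n. v a = w a"
  have "F (jshift c t (x, v)) = F (jshift c t (x, w))" for t
  proof (cases c)
    case (X i)
    then show ?thesis using assms vw by (auto simp: on_jets_def)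
  next
    case (U a)
    have "\<forall>b\<in>jidx n. (v(a := v a + t)) b = (w(a := w a + t)) b" using vw by simp
    then show ?thesis using assms U unfolding on_jets_def by simp
  qed
  then show "pd jshift c F (x, v) = pd jshift c F (x, w)" by (simp add: pd_def)
qed

lemma on_jets_shift_higher:
  assumes "on_jets n F" "a \<notin> jidx n" shows "F (jshift (U a) t z) = F z"
proof (cases z)
  case (Pair x v)
  have "\<forall>b\<in>jidx n. (v(a := v a + t)) b = v b" using assms(2) by auto
  then show ?thesis using assms(1) Pair unfolding on_jets_def by simp
qed

text \<open>The derivatives along the coordinates of higher order vanish, so that the order need not
  be tracked when smoothness is concerned.\<close>

lemma smooth_on_all_jcoords:
  assumes op: "open (\<Omega> :: (real ^ 'p::finite) set)"
    and F: "on_jets n F" "smooth_on jshift (jcoords n) (\<Omega> \<times> UNIV) F"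
  shows "smooth_on jshift UNIV (\<Omega> \<times> UNIV) (F :: ('p, 'q) jet \<Rightarrow> real)"
proof -
  interpret coordinate_space "jshift :: ('p, 'q) jcoord \<Rightarrow> _" UNIV "\<Omega> \<times> UNIV"
    by (rule coordinate_space_jshift[OF op])
  interpret n: coordinate_space "jshift :: ('p, 'q) jcoord \<Rightarrow> _" "jcoords n" "\<Omega> \<times> UNIV"
    by (rule coordinate_space_jshift[OF op])
  show ?thesis
  proof (rule smooth_on_coinduct[where P = "\<lambda>F. on_jets n F \<and> smooth_on jshift (jcoords n) (\<Omega> \<times> UNIV) F"])
    fix F :: "('p, 'q) jet \<Rightarrow> real" and c :: "('p, 'q) jcoord"
    assume F: "on_jets n F \<and> smooth_on jshift (jcoords n) (\<Omega> \<times> UNIV) F"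
    show "\<exists>g. (on_jets n g \<and> smooth_on jshift (jcoords n) (\<Omega> \<times> UNIV) g) \<and>
        (\<forall>z\<in>\<Omega> \<times> UNIV. ((\<lambda>t. F (jshift c t z)) has_real_derivative g z) (at 0))"
    proof (cases "c \<in> jcoords n")
      case True
      then show ?thesis
        using F by (intro exI[of _ "pd jshift c F"])
          (auto intro!: on_jets_pd smooth_on_pd simp del: split_paired_All dest: smooth_on_has_pd)
    next
      case False
      then obtain a where "c = U a" "a \<notin> jidx n" by (cases c) (auto simp: jcoords_def)
      then have "F (jshift c t z) = F z" for t z
        using on_jets_shift_higher F by blast
      then show ?thesis
        by (intro exI[of _ "\<lambda>_. 0"]) (simp add: n.smooth_on_const on_jets_def)
    qed
  next
    show "continuous_on (\<Omega> \<times> UNIV) F"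
      if "on_jets n F \<and> smooth_on jshift (jcoords n) (\<Omega> \<times> UNIV) F" for F :: "('p, 'q) jet \<Rightarrow> real"
      using that smooth_on_continuous by blast
  qed (simp add: F)
qed

lemma signed_mean_value:
  fixes g :: "real \<Rightarrow> real"
  assumes "\<And>r. (g has_real_derivative g' r) (at r)"
  shows "\<exists>s. \<bar>s - p\<bar> \<le> \<bar>q - p\<bar> \<and> g q - g p = (q - p) * g' s"
proof (cases p q rule: linorder_cases)
  case less
  from MVT2[OF this assms] show ?thesis by force
next
  case greater
  from MVT2[OF this assms] obtain s where "q < s" "s < p" "g p - g q = (p - q) * g' s" by blast
  then show ?thesis by (intro exI[of _ s]) (auto simp: algebra_simps)
qed auto

text \<open>Partial derivatives that are continuous give the chain rule. Moving the coordinates one by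
  one avoids any notion of total differentiability on jet space: each move is controlled by the
  mean value theorem.\<close>

lemma jet_chain_rule:
  fixes F :: "('p::finite, 'q) jet \<Rightarrow> real"
  assumes op: "open \<Omega>" and F: "smooth_on jshift UNIV (\<Omega> \<times> UNIV) F" and fin: "finite A"
    and T: "open T" "0 \<in> T" and x: "continuous_on T x" "\<And>t. t \<in> T \<Longrightarrow> x t \<in> \<Omega>"
    and w: "\<And>a. continuous_on T (\<lambda>t. w t a)"
    and d: "((\<lambda>t. F (x t, w 0)) has_real_derivative d) (at 0)"
    and w': "\<And>a. a \<in> A \<Longrightarrow> ((\<lambda>t. w t a) has_real_derivative w' a) (at 0)"
  shows "((\<lambda>t. F (x t, \<lambda>a. if a \<in> A then w t a else w 0 a)) has_real_derivative
      d + (\<Sum>a\<in>A. w' a * pd jshift (U a) F (x 0, w 0))) (at 0)"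
  using fin w'
proof (induction A)
  case empty
  then show ?case using d by simp
next
  case (insert a A)
  interpret coordinate_space "jshift :: ('p, 'q) jcoord \<Rightarrow> _" UNIV "\<Omega> \<times> UNIV"
    by (rule coordinate_space_jshift[OF op])
  define W where "W t = (\<lambda>b. if b \<in> A then w t b else w 0 b)" for t
  define D where "D t s = pd jshift (U a) F (x t, (W t)(a := s))" for t s
  have along: "((\<lambda>r. F (x t, (W t)(a := r))) has_real_derivative D t r) (at r)" if "t \<in> T" for t r
    using has_pd_along[OF F, of "U a" r "(x t, (W t)(a := 0))"] x(2)[OF that]
    by (simp add: D_def)
  have "\<exists>s. \<bar>s - w 0 a\<bar> \<le> \<bar>w t a - w 0 a\<bar> \<and>
      F (x t, (W t)(a := w t a)) - F (x t, (W t)(a := w 0 a)) = (w t a - w 0 a) * D t s"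
    if "t \<in> T" for t
    by (rule signed_mean_value) (rule along[OF that])
  then obtain s where s: "\<And>t. t \<in> T \<Longrightarrow> \<bar>s t - w 0 a\<bar> \<le> \<bar>w t a - w 0 a\<bar>"
    "\<And>t. t \<in> T \<Longrightarrow> F (x t, (W t)(a := w t a)) - F (x t, (W t)(a := w 0 a)) = (w t a - w 0 a) * D t (s t)"
    by metis
  \<comment> \<open>\<open>H\<close> is the effect of moving the coordinate \<open>a\<close> last; the induction hypothesis covers the others.\<close>
  define H where "H t = F (x t, (W t)(a := w t a)) - F (x t, W t)" for t
  have Wa: "(W t)(a := w 0 a) = W t" for t using insert.hyps by (auto simp: W_def)
  have W0: "W 0 = w 0" by (auto simp: W_def)
  have evT: "\<forall>\<^sub>F t in at 0. t \<in> T"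
    using T by (auto simp: eventually_at_topological)
  have wlim: "(\<lambda>t. w t b) \<midarrow>0\<rightarrow> w 0 b" for b
    using w[of b] T by (auto simp: continuous_on_eq_continuous_at isCont_def)
  have slim: "s \<midarrow>0\<rightarrow> w 0 a"
  proof (rule LIM_zero_cancel, rule Lim_null_comparison)
    show "\<forall>\<^sub>F t in at 0. norm (s t - w 0 a) \<le> \<bar>w t a - w 0 a\<bar>"
      using evT by eventually_elim (use s in auto)
    show "(\<lambda>t. \<bar>w t a - w 0 a\<bar>) \<midarrow>0\<rightarrow> 0"
      using LIM_zero[OF wlim] by (rule tendsto_rabs_zero)
  qed
  \<comment> \<open>Joint continuity lets the intermediate value \<open>s t\<close> of the mean value theorem be any function tending to \<open>w 0 a\<close>.\<close>
  have "continuous_on (T \<times> UNIV) (\<lambda>(t, r). D t r)"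
  proof -
    have "continuous_on (T \<times> UNIV) (\<lambda>y. (x (fst y), (W (fst y))(a := snd y)))"
    proof (intro continuous_on_Pair continuous_on_coordinatewise_then_product)
      show "continuous_on (T \<times> UNIV) (\<lambda>y. x (fst y))"
        by (rule continuous_on_compose2[OF x(1)]) (auto intro!: continuous_intros)
      fix b
      show "continuous_on (T \<times> (UNIV :: real set)) (\<lambda>y. ((W (fst y))(a := snd y)) b)"
        using continuous_on_compose2[OF w[of b] continuous_on_fst[OF continuous_on_id[of "T \<times> UNIV"]]]
        by (cases "b = a"; cases "b \<in> A") (auto simp: W_def intro!: continuous_intros)
    qed
    then have "continuous_on (T \<times> UNIV) (\<lambda>y. pd jshift (U a) F (x (fst y), (W (fst y))(a := snd y)))"
      using x(2) by (intro continuous_on_compose2[OF smooth_on_continuous[OF smooth_on_pd[OF F]]]) auto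
    then show ?thesis by (simp add: D_def split_def)
  qed
  then have "isCont (\<lambda>(t, r). D t r) (0, w 0 a)"
    using T by (simp add: continuous_on_eq_continuous_at open_Times)
  then have Dlim: "(\<lambda>t. D t (s t)) \<midarrow>0\<rightarrow> D 0 (w 0 a)"
    using isCont_tendsto_compose[OF _ tendsto_Pair[OF tendsto_ident_at slim]] by fastforce
  have D0: "D 0 (w 0 a) = pd jshift (U a) F (x 0, w 0)"
    using Wa[of 0] by (simp add: D_def W0)
  have "(H has_real_derivative w' a * D 0 (w 0 a)) (at 0)"
    unfolding has_field_derivative_iff
  proof (rule Lim_transform_eventually)
    show "(\<lambda>t. (w t a - w 0 a) / (t - 0) * D t (s t)) \<midarrow>0\<rightarrow> w' a * D 0 (w 0 a)"
      using insert.prems[of a] Dlim by (intro tendsto_mult) (auto simp: has_field_derivative_iff)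
    show "\<forall>\<^sub>F t in at 0. (w t a - w 0 a) / (t - 0) * D t (s t) = (H t - H 0) / (t - 0)"
      using evT
    proof eventually_elim
      case (elim t)
      have "H 0 = 0" using Wa[of 0] by (simp add: H_def)
      then show ?case using s(2)[OF elim] Wa[of t] by (simp add: H_def)
    qed
  qed
  moreover have "((\<lambda>t. F (x t, W t)) has_real_derivative
      d + (\<Sum>a\<in>A. w' a * pd jshift (U a) F (x 0, w 0))) (at 0)"
    using insert.IH insert.prems by (simp add: W_def)
  ultimately have "((\<lambda>t. F (x t, W t) + H t) has_real_derivative
      (d + (\<Sum>a\<in>A. w' a * pd jshift (U a) F (x 0, w 0))) + w' a * D 0 (w 0 a)) (at 0)"
    by (rule DERIV_add[rotated])
  moreover have "F (x t, W t) + H t = F (x t, \<lambda>b. if b \<in> insert a A then w t b else w 0 b)" for t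
  proof -
    have "(W t)(a := w t a) = (\<lambda>b. if b \<in> insert a A then w t b else w 0 b)"
      by (auto simp: W_def)
    then show ?thesis by (simp add: H_def)
  qed
  moreover have "(d + (\<Sum>a\<in>A. w' a * pd jshift (U a) F (x 0, w 0))) + w' a * D 0 (w 0 a) =
      d + (\<Sum>a\<in>insert a A. w' a * pd jshift (U a) F (x 0, w 0))"
    using insert.hyps by (simp add: D0)
  ultimately show ?case by (simp only:)
qed

section \<open>Total derivatives along a jet\<close>

lemma continuous_on_jet:
  fixes u :: "'q \<Rightarrow> real ^ 'p::finite \<Rightarrow> real"
  assumes "\<And>\<alpha>. smooth_on xshift UNIV \<Omega> (u \<alpha>)"
  shows "continuous_on \<Omega> (jet u)"
  unfolding jet_def[abs_def]
proof (intro continuous_on_Pair continuous_on_coordinatewise_then_product continuous_on_id)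
  fix a :: "'q \<times> 'p multiset"
  show "continuous_on \<Omega> (\<lambda>x. case a of (\<alpha>, J) \<Rightarrow> pds xshift (ordering J) (u \<alpha>) x)"
    using smooth_on_continuous[OF smooth_on_pds[OF assms]] by (cases a) simp
qed

text \<open>This is the defining property of total derivatives. The coordinates of a jet are derivatives
  taken in a chosen order, whence the use of the symmetry of mixed partial derivatives.\<close>

lemma has_pd_along_jet:
  fixes F :: "('p::finite, 'q::finite) jet \<Rightarrow> real"
  assumes op: "open \<Omega>" and F: "on_jets k F" "smooth_on jshift UNIV (\<Omega> \<times> UNIV) F"
    and u: "\<And>\<alpha>. smooth_on xshift UNIV \<Omega> (u \<alpha>)" and y: "y \<in> \<Omega>"
  shows "((\<lambda>t. F (jet u (xshift i t y))) has_real_derivative total_deriv k i F (jet u y)) (at 0)"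
proof -
  interpret coordinate_space xshift UNIV \<Omega> by (rule coordinate_space_xshift[OF op])
  define x where "x t = xshift i t y" for t
  define w where "w t = snd (jet u (x t))" for t
  define T where "T = x -` \<Omega>"
  have cx: "continuous_on UNIV x"
    unfolding x_def[abs_def] xshift_def by (intro continuous_intros)
  have x0: "x 0 = y" by (simp add: x_def shift_zero)
  have T: "open T" "0 \<in> T" "\<And>t. t \<in> T \<Longrightarrow> x t \<in> \<Omega>"
    using open_vimage[OF op cx] x0 y by (auto simp: T_def)
  have w: "continuous_on T (\<lambda>t. w t a)" for a
  proof (cases a)
    case (Pair \<alpha> J)
    have "continuous_on T (\<lambda>t. pds xshift (ordering J) (u \<alpha>) (x t))"
      using T(3) cx
      by (intro continuous_on_compose2[OF smooth_on_continuous[OF smooth_on_pds[OF u]]])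
        (auto intro: continuous_on_subset)
    then show ?thesis by (simp add: w_def jet_def Pair)
  qed
  have "((\<lambda>t. w t (\<alpha>, J)) has_real_derivative w 0 (\<alpha>, add_mset i J)) (at 0)" for \<alpha> J
  proof -
    have "((\<lambda>t. pds xshift (ordering J) (u \<alpha>) (xshift i t y)) has_real_derivative
        pd xshift i (pds xshift (ordering J) (u \<alpha>)) y) (at 0)"
      by (rule smooth_on_has_pd[OF smooth_on_pds[OF u] _ y]) auto
    moreover have "pds xshift (i # ordering J) (u \<alpha>) y = pds xshift (ordering (add_mset i J)) (u \<alpha>) y"
      by (rule pds_permute[OF u op _ y]) (simp add: mset_ordering)
    ultimately show ?thesis
      unfolding w_def jet_def x_def shift_zero by simp
  qed
  moreover have "((\<lambda>t. F (x t, w 0)) has_real_derivative pd jshift (X i) F (y, w 0)) (at 0)"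
    using smooth_on_has_pd[OF F(2), of "X i" "(y, w 0)"] y by (simp add: x_def)
  moreover have "continuous_on T x" using cx by (rule continuous_on_subset) simp
  ultimately have "((\<lambda>t. F (x t, \<lambda>a. if a \<in> jidx k then w t a else w 0 a)) has_real_derivative
      pd jshift (X i) F (y, w 0) +
      (\<Sum>a\<in>jidx k. w 0 (fst a, add_mset i (snd a)) * pd jshift (U a) F (x 0, w 0))) (at 0)"
    using T w by (intro jet_chain_rule[OF op F(2) finite_jidx, of T]) auto
  moreover have "F (x t, \<lambda>a. if a \<in> jidx k then w t a else w 0 a) = F (jet u (xshift i t y))" for t
  proof -
    have "jet u (xshift i t y) = (x t, w t)" by (simp add: w_def x_def jet_def)
    then show ?thesis using F(1) by (simp add: on_jets_def)
  qed
  moreover have "(y, w 0) = jet u y" by (simp add: w_def x0 jet_def)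
  moreover have "w 0 = snd (jet u y)" by (simp add: w_def x0)
  ultimately show ?thesis
    by (simp add: total_deriv_def x0 split_def)
qed

text \<open>Affine functions of one coordinate form a class that is closed under partial derivatives.\<close>

lemma smooth_on_jet_coordinate:
  assumes op: "open (\<Omega> :: (real ^ 'p::finite) set)"
  shows "smooth_on jshift UNIV (\<Omega> \<times> UNIV) (\<lambda>z :: ('p, 'q) jet. snd z a)"
proof -
  interpret coordinate_space "jshift :: ('p, 'q) jcoord \<Rightarrow> _" UNIV "\<Omega> \<times> UNIV"
    by (rule coordinate_space_jshift[OF op])
  define P where "P f \<longleftrightarrow> (\<exists>p q. f = (\<lambda>z :: ('p, 'q) jet. p * snd z a + q))" for f
  have P: "P (\<lambda>z. p * snd z a + q)" for p q
    unfolding P_def by (rule exI, rule exI, rule refl)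
  show ?thesis
  proof (rule smooth_on_coinduct[where P = P])
    show "P (\<lambda>z. snd z a)" using P[of 1 0] by simp
  next
    fix f assume "P f"
    then obtain p q where f: "f = (\<lambda>z. p * snd z a + q)" unfolding P_def by (elim exE)
    show "continuous_on (\<Omega> \<times> UNIV) f"
      unfolding f by (intro continuous_intros continuous_on_product_then_coordinatewise)
    fix c :: "('p, 'q) jcoord"
    define d where "d = (if c = U a then 1 else 0 :: real)"
    have eq: "f (jshift c t z) = p * (snd z a + d * t) + q" for t z
      by (cases z; cases c) (simp_all add: f d_def)
    have "((\<lambda>t. f (jshift c t z)) has_real_derivative p * d) (at 0)" for z
      unfolding eq by (auto intro!: derivative_eq_intros)
    then show "\<exists>g. P g \<and> (\<forall>z\<in>\<Omega> \<times> UNIV. ((\<lambda>t. f (jshift c t z)) has_real_derivative g z) (at 0))"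
      using P[of 0 "p * d"] by (intro exI[of _ "\<lambda>_. p * d"]) simp
  qed
qed

lemma smooth_on_total_deriv:
  assumes op: "open (\<Omega> :: (real ^ 'p::finite) set)" and F: "smooth_on jshift UNIV (\<Omega> \<times> UNIV) F"
  shows "smooth_on jshift UNIV (\<Omega> \<times> UNIV) (total_deriv k i F :: ('p, 'q::finite) jet \<Rightarrow> real)"
proof -
  interpret coordinate_space "jshift :: ('p, 'q) jcoord \<Rightarrow> _" UNIV "\<Omega> \<times> UNIV"
    by (rule coordinate_space_jshift[OF op])
  have summand: "smooth_on jshift UNIV (\<Omega> \<times> UNIV) (\<lambda>z :: ('p, 'q) jet. snd z a * pd jshift (U b) F z)"
    for a b
    by (rule smooth_on_mult[OF smooth_on_jet_coordinate[OF op] smooth_on_pd[OF F UNIV_I]])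
  have "smooth_on jshift UNIV (\<Omega> \<times> UNIV) (\<lambda>z :: ('p, 'q) jet.
      (\<Sum>a\<in>jidx k. snd z (fst a, add_mset i (snd a)) * pd jshift (U a) F z))"
    by (rule smooth_on_sum) (rule summand)
  then have "smooth_on jshift UNIV (\<Omega> \<times> UNIV) (\<lambda>z :: ('p, 'q) jet. pd jshift (X i) F z +
      (\<Sum>a\<in>jidx k. snd z (fst a, add_mset i (snd a)) * pd jshift (U a) F z))"
    by (intro smooth_on_add smooth_on_pd F UNIV_I)
  then show ?thesis
    unfolding total_deriv_def[abs_def] split_def prod.collapse .
qed

lemma on_jets_total_deriv:
  fixes F :: "('p::finite, 'q::finite) jet \<Rightarrow> real"
  assumes F: "on_jets k F" shows "on_jets (Suc k) (total_deriv k i F)"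
  unfolding on_jets_def
proof (intro allI impI)
  fix x and v w :: "'q \<times> 'p multiset \<Rightarrow> real" assume vw: "\<forall>a\<in>jidx (Suc k). v a = w a"
  have "jidx k \<subseteq> (jidx (Suc k) :: ('q \<times> 'p multiset) set)" by (auto simp: jidx_def)
  with vw have vw': "\<forall>a\<in>jidx k. v a = w a" by blast
  have pd: "pd jshift c F (x, v) = pd jshift c F (x, w)" for c
    by (rule on_jets_pd[OF F, unfolded on_jets_def, rule_format]) (use vw' in blast)
  have "v (\<alpha>, add_mset i J) = w (\<alpha>, add_mset i J)" if "(\<alpha>, J) \<in> jidx k" for \<alpha> J
    using bspec[OF vw, of "(\<alpha>, add_mset i J)"] that by (simp add: jidx_def)
  then have "(\<Sum>(\<alpha>, J)\<in>jidx k. snd (x, v) (\<alpha>, add_mset i J) * pd jshift (U (\<alpha>, J)) F (x, v)) =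
      (\<Sum>(\<alpha>, J)\<in>jidx k. snd (x, w) (\<alpha>, add_mset i J) * pd jshift (U (\<alpha>, J)) F (x, w))"
    by (intro sum.cong refl) (clarsimp simp: pd)
  then show "total_deriv k i F (x, v) = total_deriv k i F (x, w)"
    unfolding total_deriv_def by (simp only: pd[of "X i"])
qed

lemma total_derivs_on_jets_smooth:
  assumes "open (\<Omega> :: (real ^ 'p::finite) set)"
    and "on_jets k F" "smooth_on jshift UNIV (\<Omega> \<times> UNIV) F"
  shows "on_jets (k + length js) (total_derivs k js F)"
    and "smooth_on jshift UNIV (\<Omega> \<times> UNIV) (total_derivs k js F :: ('p, 'q::finite) jet \<Rightarrow> real)"
proof -
  show "on_jets (k + length js) (total_derivs k js F)"
  proof (induction js)
    case (Cons j js)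
    show ?case
      using on_jets_total_deriv[OF Cons, of j] by simp
  qed (use assms(2) in simp)
  show "smooth_on jshift UNIV (\<Omega> \<times> UNIV) (total_derivs k js F)"
  proof (induction js)
    case (Cons j js)
    show ?case
      unfolding total_derivs.simps by (rule smooth_on_total_deriv[OF assms(1) Cons])
  qed (use assms(3) in simp)
qed

section \<open>Integration by parts against test functions\<close>

lemma test_function_smooth: "\<phi> \<in> test_functions \<Omega> \<Longrightarrow> smooth_on xshift UNIV UNIV \<phi>"
  by (simp add: test_functions_def)

lemma test_function_smooth_on:
  "\<phi> \<in> test_functions \<Omega> \<Longrightarrow> smooth_on xshift UNIV S \<phi>"
  unfolding test_functions_def smooth_on_def by (auto intro: continuous_on_subset)

text \<open>Off the support of \<open>\<phi>\<close>, which is closed, \<open>\<phi>\<close> vanishes in a neighbourhood of each point, and so does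
  its derivative.\<close>

lemma test_function_pd:
  assumes "\<phi> \<in> test_functions \<Omega>" shows "pd xshift i \<phi> \<in> test_functions \<Omega>"
proof -
  define K where "K = closure {x. \<phi> x \<noteq> 0}"
  have K: "compact K" "K \<subseteq> \<Omega>" and sm: "smooth_on xshift UNIV UNIV \<phi>"
    using assms by (auto simp: test_functions_def K_def)
  interpret coordinate_space xshift UNIV "- K"
    by (rule coordinate_space_xshift) (simp add: K_def open_Compl)
  have "pd xshift i \<phi> x = 0" if "x \<in> - K" for x
  proof -
    have "\<phi> y = 0" if "y \<in> - K" for y
      using that closure_subset[of "{x. \<phi> x \<noteq> 0}"] by (auto simp: K_def)
    then have "pd xshift i \<phi> x = pd xshift i (\<lambda>_. 0) x"
      using that by (intro pd_cong) auto
    then show ?thesis by (simp add: pd_def)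
  qed
  then have "{x. pd xshift i \<phi> x \<noteq> 0} \<subseteq> K" by auto
  then have "closure {x. pd xshift i \<phi> x \<noteq> 0} \<subseteq> K"
    by (rule closure_minimal) (simp add: K(1) compact_imp_closed)
  then have "compact (closure {x. pd xshift i \<phi> x \<noteq> 0})" "closure {x. pd xshift i \<phi> x \<noteq> 0} \<subseteq> \<Omega>"
    using K compact_Int_closed[OF K(1) closed_closure[of "{x. pd xshift i \<phi> x \<noteq> 0}"]]
    by (auto simp: Int_absorb1)
  then show ?thesis
    using smooth_on_pd[OF sm] by (simp add: test_functions_def)
qed

lemma test_function_pds: "\<phi> \<in> test_functions \<Omega> \<Longrightarrow> pds xshift cs \<phi> \<in> test_functions \<Omega>"
  by (induction cs) (auto intro: test_function_pd)

lemma test_function_bounded: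
  assumes "\<phi> \<in> test_functions \<Omega>" obtains B where "\<And>x. \<bar>\<phi> x\<bar> \<le> B"
proof -
  define K where "K = closure {x. \<phi> x \<noteq> 0}"
  have K: "compact K" using assms by (auto simp: test_functions_def K_def)
  have "continuous_on K \<phi>"
    by (rule smooth_on_continuous[OF test_function_smooth_on[OF assms]])
  then have "bounded (\<phi> ` K)" using K by (intro compact_imp_bounded compact_continuous_image)
  then obtain B where B: "\<And>x. x \<in> K \<Longrightarrow> \<bar>\<phi> x\<bar> \<le> B" unfolding bounded_iff by auto
  have "\<bar>\<phi> x\<bar> \<le> max B 0" for x
  proof (cases "\<phi> x = 0")
    case False
    then have "x \<in> K" using closure_subset[of "{x. \<phi> x \<noteq> 0}"] by (auto simp: K_def)
    from B[OF this] show ?thesis by simp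
  qed simp
  then show ?thesis by (rule that)
qed

text \<open>Nothing is known about \<open>g\<close> near the boundary of \<open>\<Omega>\<close>. Extension by zero is nevertheless continuous,
  because \<open>\<Omega>\<close> and the complement of the support of \<open>\<phi>\<close> form an open cover.\<close>

lemma continuous_on_times_test_function:
  assumes op: "open \<Omega>" and g: "continuous_on \<Omega> g" and \<phi>: "\<phi> \<in> test_functions \<Omega>"
  shows "continuous_on UNIV (\<lambda>x. indicat_real \<Omega> x *\<^sub>R (g x * \<phi> x))"
proof -
  define K where "K = closure {x. \<phi> x \<noteq> 0}"
  have K: "closed K" "K \<subseteq> \<Omega>" using \<phi> by (auto simp: test_functions_def K_def)
  have zero: "\<phi> x = 0" if "x \<notin> K" for x
    using that closure_subset[of "{x. \<phi> x \<noteq> 0}"] by (auto simp: K_def)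
  have "continuous_on \<Omega> (\<lambda>x. g x * \<phi> x)"
    using g smooth_on_continuous[OF test_function_smooth_on[OF \<phi>]] by (rule continuous_on_mult)
  then have "continuous_on \<Omega> (\<lambda>x. indicat_real \<Omega> x *\<^sub>R (g x * \<phi> x))"
    by (rule continuous_on_eq) simp
  moreover have "continuous_on (- K) (\<lambda>x. indicat_real \<Omega> x *\<^sub>R (g x * \<phi> x))"
    by (rule continuous_on_eq[of _ "\<lambda>_. 0"]) (simp_all add: zero)
  ultimately have "continuous_on (\<Omega> \<union> - K) (\<lambda>x. indicat_real \<Omega> x *\<^sub>R (g x * \<phi> x))"
    using op K by (intro continuous_on_open_Un) auto
  moreover have "\<Omega> \<union> - K = UNIV" using K by auto
  ultimately show ?thesis by simp
qed

lemma integrable_continuous_compact_support: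
  fixes h :: "'a::euclidean_space \<Rightarrow> real"
  assumes "continuous_on UNIV h" "compact K" "\<And>x. x \<notin> K \<Longrightarrow> h x = 0"
  shows "integrable lborel h"
proof -
  have "integrable lborel (\<lambda>x. indicator K x *\<^sub>R h x)"
    by (rule borel_integrable_compact[OF assms(2)]) (rule continuous_on_subset[OF assms(1)], simp)
  moreover have "(\<lambda>x. indicator K x *\<^sub>R h x) = h"
    using assms(3) by (auto simp: indicator_def fun_eq_iff)
  ultimately show ?thesis by simp
qed

lemma set_integrable_times_test_function:
  assumes op: "open \<Omega>" and g: "continuous_on \<Omega> g" and \<phi>: "\<phi> \<in> test_functions \<Omega>"
  shows "set_integrable lborel \<Omega> (\<lambda>x. g x * \<phi> x)"
  unfolding set_integrable_def
proof (rule integrable_continuous_compact_support[OF continuous_on_times_test_function[OF assms]])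
  show "compact (closure {x. \<phi> x \<noteq> 0})" using \<phi> by (simp add: test_functions_def)
  show "indicat_real \<Omega> x *\<^sub>R (g x * \<phi> x) = 0" if "x \<notin> closure {x. \<phi> x \<noteq> 0}" for x
    using that closure_subset[of "{x. \<phi> x \<noteq> 0}"] by auto
qed

lemma set_integral_sum_finite:
  fixes f :: "'i \<Rightarrow> 'a \<Rightarrow> real"
  assumes "\<And>i. i \<in> I \<Longrightarrow> set_integrable M A (f i)"
  shows "(LINT x:A|M. \<Sum>i\<in>I. f i x) = (\<Sum>i\<in>I. LINT x:A|M. f i x)"
  using assms unfolding set_integrable_def set_lebesgue_integral_def scaleR_sum_right
  by (rule Bochner_Integration.integral_sum)

text \<open>Lebesgue measure is invariant under translations, so the difference quotients of \<open>h\<close> have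
  integral zero, and they converge dominatedly. No iterated integral is needed.\<close>

lemma integral_partial_derivative_eq_0:
  fixes h h' :: "real ^ 'p::finite \<Rightarrow> real"
  assumes h: "continuous_on UNIV h" and h': "continuous_on UNIV h'"
    and der: "\<And>x. ((\<lambda>t. h (xshift i t x)) has_real_derivative h' x) (at 0)"
    and K: "compact K" "\<And>x. x \<notin> K \<Longrightarrow> h x = 0" "\<And>x. x \<notin> K \<Longrightarrow> h' x = 0"
  shows "integral\<^sup>L lborel h' = 0"
proof -
  define e :: "real ^ 'p" where "e = axis i 1"
  define \<delta> where "\<delta> n = 1 / real (Suc n)" for n
  have \<delta>: "0 < \<delta> n" "\<delta> n \<le> 1" for n by (auto simp: \<delta>_def)
  \<comment> \<open>Difference quotients along the sequence \<open>\<delta>\<close>; the bound \<open>\<delta> n \<le> 1\<close> keeps their supports in one ball.\<close>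
  define s where "s n x = (h (x + \<delta> n *\<^sub>R e) - h x) / \<delta> n" for n x
  obtain R where R: "\<And>x. x \<in> K \<Longrightarrow> norm x \<le> R"
    using compact_imp_bounded[OF K(1)] unfolding bounded_iff by auto
  have "continuous_on K h'" using h' by (rule continuous_on_subset) simp
  then have "bounded (h' ` K)" using K(1) by (intro compact_imp_bounded compact_continuous_image)
  then obtain B0 where B0: "\<And>x. x \<in> K \<Longrightarrow> \<bar>h' x\<bar> \<le> B0" unfolding bounded_iff by auto
  define B where "B = max B0 0"
  have B: "\<bar>h' x\<bar> \<le> B" for x
    using B0[of x] K(3)[of x] by (cases "x \<in> K") (auto simp: B_def)
  have along: "((\<lambda>t. h (x + t *\<^sub>R e)) has_real_derivative h' (x + t *\<^sub>R e)) (at t)" for x t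
  proof -
    have "xshift i r (x + t *\<^sub>R e) = x + (r + t) *\<^sub>R e" for r
      by (simp add: xshift_def e_def scaleR_left_distrib)
    then have "((\<lambda>r. h (x + (r + t) *\<^sub>R e)) has_real_derivative h' (x + t *\<^sub>R e)) (at 0)"
      using der[of "x + t *\<^sub>R e"] by simp
    then show ?thesis
      using DERIV_shift[of "\<lambda>t. h (x + t *\<^sub>R e)" _ 0 t] by simp
  qed
  have lim: "(\<lambda>n. s n x) \<longlonglongrightarrow> h' x" for x
  proof -
    have "(\<lambda>t. (h (x + t *\<^sub>R e) - h x) / t) \<midarrow>0\<rightarrow> h' x"
      using along[of x 0] by (simp add: has_field_derivative_iff)
    moreover have "filterlim \<delta> (at 0) sequentially"
      unfolding filterlim_at
    proof
      show "\<delta> \<longlonglongrightarrow> 0" unfolding \<delta>_def[abs_def] by (rule LIMSEQ_Suc[OF lim_1_over_n])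
      show "\<forall>\<^sub>F n in sequentially. \<delta> n \<in> UNIV \<and> \<delta> n \<noteq> 0"
        using \<delta>(1) by (intro always_eventually allI) (metis UNIV_I less_irrefl)
    qed
    ultimately show ?thesis unfolding s_def by (rule filterlim_compose)
  qed
  have bound: "norm (s n x) \<le> indicator (cball 0 (R + 1)) x *\<^sub>R B" for n x
  proof (cases "x \<in> cball 0 (R + 1)")
    case True
    obtain t where "h (x + \<delta> n *\<^sub>R e) - h (x + 0 *\<^sub>R e) = (\<delta> n - 0) * h' (x + t *\<^sub>R e)"
      using MVT2[OF \<delta>(1) along] by blast
    then have "s n x = h' (x + t *\<^sub>R e)" using \<delta>(1)[of n] by (simp add: s_def)
    then show ?thesis using B True by simp
  next
    case False
    have "norm (\<delta> n *\<^sub>R e) \<le> 1" using \<delta>[of n] by (simp add: e_def)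
    then have "norm x \<le> norm (x + \<delta> n *\<^sub>R e) + 1"
      using norm_triangle_ineq4[of "x + \<delta> n *\<^sub>R e" "\<delta> n *\<^sub>R e"] by simp
    then have "x \<notin> K" "x + \<delta> n *\<^sub>R e \<notin> K"
      using False R[of x] R[of "x + \<delta> n *\<^sub>R e"] by auto
    then show ?thesis using K(2) False by (simp add: s_def)
  qed
  have int_h: "integrable lborel h"
    by (rule integrable_continuous_compact_support[OF h K(1,2)])
  have [measurable]: "h \<in> borel_measurable borel" "h' \<in> borel_measurable borel"
    using h h' borel_measurable_continuous_onI by auto
  have trans: "integrable lborel (\<lambda>x. h (c + x))" "integral\<^sup>L lborel (\<lambda>x. h (c + x)) = integral\<^sup>L lborel h" for c
  proof -
    show "integrable lborel (\<lambda>x. h (c + x))"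
      using integrable_distr[of "(+) c" lborel borel h] int_h by (simp add: lborel_distr_plus)
    have "integral\<^sup>L (distr lborel borel ((+) c)) h = integral\<^sup>L lborel (\<lambda>x. h (c + x))"
      by (rule integral_distr) auto
    then show "integral\<^sup>L lborel (\<lambda>x. h (c + x)) = integral\<^sup>L lborel h"
      by (simp add: lborel_distr_plus)
  qed
  have "integral\<^sup>L lborel (s n) = 0" for n
  proof -
    have "s n = (\<lambda>x. (h (\<delta> n *\<^sub>R e + x) - h x) / \<delta> n)"
      by (simp add: s_def[abs_def] add.commute)
    then show ?thesis using trans[of "\<delta> n *\<^sub>R e"] int_h by simp
  qed
  moreover have "(\<lambda>n. integral\<^sup>L lborel (s n)) \<longlonglongrightarrow> integral\<^sup>L lborel h'"
  proof (rule integral_dominated_convergence)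
    show "integrable lborel (\<lambda>x. indicator (cball 0 (R + 1)) x *\<^sub>R B)"
      by (rule borel_integrable_compact) auto
    show "s n \<in> borel_measurable lborel" for n
      unfolding s_def[abs_def] by measurable
  qed (use lim bound in auto)
  ultimately show ?thesis
    by (simp add: LIMSEQ_const_iff)
qed

text \<open>The product \<open>g \<phi>\<close>, extended by zero, is continuously differentiable with compact support on the
  whole space, so that the integral of its derivative vanishes.\<close>

lemma integral_by_parts_test_function:
  fixes g g' :: "real ^ 'p::finite \<Rightarrow> real"
  assumes op: "open \<Omega>" and g: "continuous_on \<Omega> g" and g': "continuous_on \<Omega> g'"
    and der: "\<And>x. x \<in> \<Omega> \<Longrightarrow> ((\<lambda>t. g (xshift i t x)) has_real_derivative g' x) (at 0)"
    and \<phi>: "\<phi> \<in> test_functions \<Omega>"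
  shows "(LINT x:\<Omega>|lborel. g' x * \<phi> x) = - (LINT x:\<Omega>|lborel. g x * pd xshift i \<phi> x)"
proof -
  define K where "K = closure {x. \<phi> x \<noteq> 0}"
  have K: "compact K" "K \<subseteq> \<Omega>" using \<phi> by (auto simp: test_functions_def K_def)
  have zero: "\<phi> x = 0" if "x \<notin> K" for x
    using that closure_subset[of "{x. \<phi> x \<noteq> 0}"] by (auto simp: K_def)
  interpret o: coordinate_space xshift UNIV \<Omega> by (rule coordinate_space_xshift[OF op])
  interpret k: coordinate_space xshift UNIV "- K"
    by (rule coordinate_space_xshift) (simp add: K(1) compact_imp_closed open_Compl)
  have zero': "pd xshift i \<phi> x = 0" if "x \<notin> K" for x
    using k.pd_cong[of i x \<phi> "\<lambda>_. 0"] that zero by (simp add: pd_def)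
  note \<phi>' = test_function_pd[OF \<phi>, of i]
  define h where "h x = indicat_real \<Omega> x *\<^sub>R (g x * \<phi> x)" for x
  define h' where "h' x = indicat_real \<Omega> x *\<^sub>R (g' x * \<phi> x) + indicat_real \<Omega> x *\<^sub>R (g x * pd xshift i \<phi> x)" for x
  have "integral\<^sup>L lborel h' = 0"
  proof (rule integral_partial_derivative_eq_0)
    show "continuous_on UNIV h"
      unfolding h_def[abs_def] by (rule continuous_on_times_test_function[OF op g \<phi>])
    show "continuous_on UNIV h'"
      unfolding h'_def[abs_def]
      by (intro continuous_on_add continuous_on_times_test_function op g g' \<phi> \<phi>')
    show "((\<lambda>t. h (xshift i t x)) has_real_derivative h' x) (at 0)" for x
    proof (cases "x \<in> \<Omega>")
      case True
      have "((\<lambda>t. g (xshift i t x) * \<phi> (xshift i t x)) has_real_derivative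
          g' x * \<phi> (xshift i 0 x) + pd xshift i \<phi> x * g (xshift i 0 x)) (at 0)"
        by (rule DERIV_mult[OF der[OF True] smooth_on_has_pd[OF test_function_smooth[OF \<phi>]]]) auto
      then have "((\<lambda>t. g (xshift i t x) * \<phi> (xshift i t x)) has_real_derivative h' x) (at 0)"
        using True by (simp add: o.shift_zero h'_def mult.commute)
      then show ?thesis
        by (rule o.has_pd_cong[of i x "\<lambda>x. g x * \<phi> x" h, rotated 3]) (use True in \<open>simp_all add: h_def\<close>)
    next
      case False
      then have "x \<in> - K" using K by auto
      then show ?thesis
        using k.has_pd_cong[of i x "\<lambda>_. 0" h "h' x"] False zero by (simp add: h_def h'_def)
    qed
  qed (use K zero zero' in \<open>auto simp: h_def h'_def\<close>)
  moreover have "integral\<^sup>L lborel h' = (LINT x:\<Omega>|lborel. g' x * \<phi> x) + (LINT x:\<Omega>|lborel. g x * pd xshift i \<phi> x)"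
    unfolding h'_def[abs_def] set_lebesgue_integral_def
    using set_integrable_times_test_function[OF op g' \<phi>] set_integrable_times_test_function[OF op g \<phi>']
    by (intro Bochner_Integration.integral_add) (simp_all add: set_integrable_def)
  ultimately show ?thesis by simp
qed

lemma continuous_on_along_jet:
  assumes "smooth_on jshift UNIV (\<Omega> \<times> UNIV) F" "\<And>\<alpha>. smooth_on xshift UNIV \<Omega> (u \<alpha>)"
  shows "continuous_on \<Omega> (\<lambda>x. F (jet u x))"
  by (rule continuous_on_compose2[OF smooth_on_continuous[OF assms(1)] continuous_on_jet[OF assms(2)]])
    (auto simp: jet_def)

text \<open>Each integration by parts strips the outermost total derivative, whence the reversed list.\<close>

lemma integral_total_derivs:
  fixes F :: "('p::finite, 'q::finite) jet \<Rightarrow> real"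
  assumes op: "open \<Omega>" and F: "on_jets k F" "smooth_on jshift UNIV (\<Omega> \<times> UNIV) F"
    and u: "\<And>\<alpha>. smooth_on xshift UNIV \<Omega> (u \<alpha>)" and \<phi>: "\<phi> \<in> test_functions \<Omega>"
  shows "(LINT x:\<Omega>|lborel. total_derivs k js F (jet u x) * \<phi> x) =
    (-1) ^ length js * (LINT x:\<Omega>|lborel. F (jet u x) * pds xshift (rev js) \<phi> x)"
  using \<phi>
proof (induction js arbitrary: \<phi>)
  case (Cons j js)
  note G = total_derivs_on_jets_smooth[OF op F, of js]
  have "(LINT x:\<Omega>|lborel. total_derivs k (j # js) F (jet u x) * \<phi> x) =
      - (LINT x:\<Omega>|lborel. total_derivs k js F (jet u x) * pd xshift j \<phi> x)"
    unfolding total_derivs.simps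
    by (rule integral_by_parts_test_function[OF op _ _ has_pd_along_jet[OF op G u] Cons.prems])
      (intro continuous_on_along_jet smooth_on_total_deriv[OF op] G u)+
  also have "\<dots> = - ((-1) ^ length js * (LINT x:\<Omega>|lborel. F (jet u x) * pds xshift (rev js) (pd xshift j \<phi>) x))"
    by (simp add: Cons.IH[OF test_function_pd[OF Cons.prems]])
  finally show ?case by (simp add: pds_append)
qed simp

text \<open>The weak form of the Euler operator: all derivatives are thrown onto the test function.\<close>

lemma integral_euler:
  fixes F :: "('p::finite, 'q::finite) jet \<Rightarrow> real"
  assumes op: "open \<Omega>" and F: "on_jets n F" "smooth_on jshift UNIV (\<Omega> \<times> UNIV) F"
    and u: "\<And>\<alpha>. smooth_on xshift UNIV \<Omega> (u \<alpha>)" and \<phi>: "\<phi> \<in> test_functions \<Omega>"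
  shows "(LINT x:\<Omega>|lborel. euler n \<alpha> F (jet u x) * \<phi> x) =
    (LINT x:\<Omega>|lborel. \<Sum>J | size J \<le> n. pd jshift (U (\<alpha>, J)) F (jet u x) * pds xshift (ordering J) \<phi> x)"
proof -
  define \<J> :: "'p multiset set" where "\<J> = {J. size J \<le> n}"
  define G where "G J = pd jshift (U (\<alpha>, J)) F" for J
  have G: "on_jets n (G J)" "smooth_on jshift UNIV (\<Omega> \<times> UNIV) (G J)" for J
    unfolding G_def by (rule on_jets_pd[OF F(1)], rule smooth_on_pd[OF F(2) UNIV_I])
  have len: "length (ordering J) = size J" for J :: "'p multiset"
    by (metis mset_ordering size_mset)
  have int: "set_integrable lborel \<Omega> (\<lambda>x. total_derivs n (ordering J) (G J) (jet u x) * \<phi> x)" for J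
    by (intro set_integrable_times_test_function continuous_on_along_jet
        total_derivs_on_jets_smooth[OF op G] op u \<phi>)
  have int': "set_integrable lborel \<Omega> (\<lambda>x. G J (jet u x) * pds xshift (ordering J) \<phi> x)" for J
    by (intro set_integrable_times_test_function continuous_on_along_jet G op u test_function_pds \<phi>)
  have "(LINT x:\<Omega>|lborel. euler n \<alpha> F (jet u x) * \<phi> x) =
      (LINT x:\<Omega>|lborel. \<Sum>J\<in>\<J>. (-1) ^ size J * (total_derivs n (ordering J) (G J) (jet u x) * \<phi> x))"
    by (simp add: euler_def \<J>_def G_def sum_distrib_right mult.assoc)
  also have "\<dots> = (\<Sum>J\<in>\<J>. (-1) ^ size J * (LINT x:\<Omega>|lborel. total_derivs n (ordering J) (G J) (jet u x) * \<phi> x))"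
    using int by (subst set_integral_sum_finite) simp_all
  also have "\<dots> = (\<Sum>J\<in>\<J>. LINT x:\<Omega>|lborel. G J (jet u x) * pds xshift (ordering J) \<phi> x)"
  proof (rule sum.cong[OF refl])
    fix J
    have "pds xshift (rev (ordering J)) \<phi> x = pds xshift (ordering J) \<phi> x" for x
      by (rule pds_permute[OF test_function_smooth[OF \<phi>]]) auto
    then show "(-1) ^ size J * (LINT x:\<Omega>|lborel. total_derivs n (ordering J) (G J) (jet u x) * \<phi> x) =
        (LINT x:\<Omega>|lborel. G J (jet u x) * pds xshift (ordering J) \<phi> x)"
      by (simp add: integral_total_derivs[OF op G u \<phi>] len mult.assoc[symmetric] flip: power_add)
  qed
  also have "\<dots> = (LINT x:\<Omega>|lborel. \<Sum>J\<in>\<J>. G J (jet u x) * pds xshift (ordering J) \<phi> x)"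
    using int' by (subst set_integral_sum_finite) simp_all
  finally show ?thesis by (simp add: \<J>_def G_def)
qed

section \<open>Lagrangians with bounded Hessian\<close>

lemma on_jets_cong:
  "on_jets n F \<Longrightarrow> (\<And>a. a \<in> jidx n \<Longrightarrow> v a = w a) \<Longrightarrow> F (x, v) = F (x, w)"
  unfolding on_jets_def by metis

text \<open>The chain rule along a straight line in the fibre; moving to another time on the line is a mere
  change of the base point.\<close>

lemma jet_line_derivative:
  fixes F :: "('p::finite, 'q::finite) jet \<Rightarrow> real"
  assumes op: "open \<Omega>" and F: "on_jets n F" "smooth_on jshift UNIV (\<Omega> \<times> UNIV) F" and x: "x \<in> \<Omega>"
  shows "((\<lambda>t. F (x, \<lambda>a. v a + t * w a)) has_real_derivative
    (\<Sum>a\<in>jidx n. w a * pd jshift (U a) F (x, \<lambda>a. v a + t * w a))) (at t)"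
proof -
  define W where "W s a = v a + (s + t) * w a" for s a
  have "((\<lambda>s. F (x, \<lambda>a. if a \<in> jidx n then W s a else W 0 a)) has_real_derivative
      0 + (\<Sum>a\<in>jidx n. w a * pd jshift (U a) F (x, W 0))) (at 0)"
  proof (rule jet_chain_rule[OF op F(2) finite_jidx open_UNIV UNIV_I])
    show "continuous_on UNIV (\<lambda>s. W s a)" for a
      unfolding W_def by (intro continuous_intros)
    show "((\<lambda>s. W s a) has_real_derivative w a) (at 0)" for a
      unfolding W_def by (auto intro!: derivative_eq_intros)
  qed (simp_all add: x)
  moreover have "F (x, \<lambda>a. if a \<in> jidx n then W s a else W 0 a) = F (x, W s)" for s
    by (rule on_jets_cong[OF F(1)]) simp
  ultimately have "((\<lambda>s. F (x, W s)) has_real_derivative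
      (\<Sum>a\<in>jidx n. w a * pd jshift (U a) F (x, W 0))) (at 0)" by (simp only: add_0)
  then show ?thesis
    using DERIV_shift[of "\<lambda>t. F (x, \<lambda>a. v a + t * w a)" _ 0 t] by (simp add: W_def[abs_def])
qed

text \<open>For fixed \<open>x\<close> the fibre is a whole vector space, hence convex, and the mean value theorem applies
  on the segment. Applied to the first derivatives of a Lagrangian this uses the bound on the Hessian.\<close>

lemma jet_lipschitz:
  fixes F :: "('p::finite, 'q::finite) jet \<Rightarrow> real"
  assumes op: "open \<Omega>" and F: "on_jets n F" "smooth_on jshift UNIV (\<Omega> \<times> UNIV) F" and x: "x \<in> \<Omega>"
    and C: "\<And>a v. a \<in> jidx n \<Longrightarrow> \<bar>pd jshift (U a) F (x, v)\<bar> \<le> C"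
  shows "\<bar>F (x, v) - F (x, w)\<bar> \<le> C * (\<Sum>a\<in>jidx n. \<bar>v a - w a\<bar>)"
proof -
  define d where "d a = v a - w a" for a
  obtain t where t: "F (x, \<lambda>a. w a + 1 * d a) - F (x, \<lambda>a. w a + 0 * d a) =
      (1 - 0) * (\<Sum>a\<in>jidx n. d a * pd jshift (U a) F (x, \<lambda>a. w a + t * d a))"
    using MVT2[OF zero_less_one jet_line_derivative[OF op F x]] by blast
  have "(\<lambda>a. w a + 1 * d a) = v" "(\<lambda>a. w a + 0 * d a) = w" by (simp_all add: d_def fun_eq_iff)
  with t have "\<bar>F (x, v) - F (x, w)\<bar> = \<bar>\<Sum>a\<in>jidx n. d a * pd jshift (U a) F (x, \<lambda>a. w a + t * d a)\<bar>"
    by simp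
  also have "\<dots> \<le> (\<Sum>a\<in>jidx n. C * \<bar>d a\<bar>)"
  proof (rule order_trans[OF sum_abs], rule sum_mono)
    fix a :: "'q \<times> 'p multiset" assume "a \<in> jidx n"
    from mult_left_mono[OF C[OF this] abs_ge_zero[of "d a"]]
    show "\<bar>d a * pd jshift (U a) F (x, \<lambda>a. w a + t * d a)\<bar> \<le> C * \<bar>d a\<bar>"
      by (simp add: abs_mult mult.commute)
  qed
  finally show ?thesis by (simp add: d_def sum_distrib_left)
qed

text \<open>A single mean value step, combined with the Lipschitz bound on the first derivatives. It loses the factor
  \<open>1/2\<close> of the Taylor remainder, which is immaterial, and it avoids second derivatives along lines.\<close>

lemma jet_taylor:
  fixes F :: "('p::finite, 'q::finite) jet \<Rightarrow> real"
  assumes op: "open \<Omega>" and F: "on_jets n F" "smooth_on jshift UNIV (\<Omega> \<times> UNIV) F" and x: "x \<in> \<Omega>"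
    and C: "\<And>a b v. a \<in> jidx n \<Longrightarrow> b \<in> jidx n \<Longrightarrow> \<bar>pd jshift (U a) (pd jshift (U b) F) (x, v)\<bar> \<le> C" "C \<ge> 0"
  shows "\<bar>F (x, \<lambda>a. v a + t * w a) - F (x, v) - t * (\<Sum>a\<in>jidx n. w a * pd jshift (U a) F (x, v))\<bar>
    \<le> C * t\<^sup>2 * (\<Sum>a\<in>jidx n. \<bar>w a\<bar>)\<^sup>2"
proof -
  define W where "W = (\<Sum>a\<in>jidx n. \<bar>w a\<bar>)"
  define g' where "g' s = (\<Sum>a\<in>jidx n. w a * pd jshift (U a) F (x, \<lambda>a. v a + s * w a))" for s
  have "((\<lambda>t. F (x, \<lambda>a. v a + t * w a)) has_real_derivative g' s) (at s)" for s
    unfolding g'_def by (rule jet_line_derivative[OF op F x])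
  from signed_mean_value[OF this, of 0 t] obtain s where s: "\<bar>s\<bar> \<le> \<bar>t\<bar>"
    "F (x, \<lambda>a. v a + t * w a) - F (x, v) = t * g' s" by auto
  have lip: "\<bar>pd jshift (U a) F (x, \<lambda>a. v a + s * w a) - pd jshift (U a) F (x, v)\<bar> \<le> C * (\<bar>t\<bar> * W)"
    if "a \<in> jidx n" for a
  proof -
    have "\<bar>pd jshift (U a) F (x, \<lambda>a. v a + s * w a) - pd jshift (U a) F (x, v)\<bar>
        \<le> C * (\<Sum>b\<in>jidx n. \<bar>v b + s * w b - v b\<bar>)"
      by (rule jet_lipschitz[OF op on_jets_pd[OF F(1)] smooth_on_pd[OF F(2) UNIV_I] x C(1)[OF _ that]])
    also have "(\<Sum>b\<in>jidx n. \<bar>v b + s * w b - v b\<bar>) = \<bar>s\<bar> * W"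
      by (simp add: W_def abs_mult sum_distrib_left)
    also have "C * (\<bar>s\<bar> * W) \<le> C * (\<bar>t\<bar> * W)"
      using s(1) C(2) by (intro mult_left_mono mult_right_mono) (auto simp: W_def sum_nonneg)
    finally show ?thesis .
  qed
  have "g' s - g' 0 = (\<Sum>a\<in>jidx n. w a * (pd jshift (U a) F (x, \<lambda>a. v a + s * w a) - pd jshift (U a) F (x, v)))"
    by (simp add: g'_def sum_subtractf right_diff_distrib)
  also have "\<bar>\<dots>\<bar> \<le> (\<Sum>a\<in>jidx n. \<bar>w a\<bar> * (C * (\<bar>t\<bar> * W)))"
    by (rule order_trans[OF sum_abs], rule sum_mono) (simp add: abs_mult mult_left_mono lip)
  also have "\<dots> = W * (C * (\<bar>t\<bar> * W))"
    by (simp add: W_def sum_distrib_right)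
  finally have "\<bar>t\<bar> * \<bar>g' s - g' 0\<bar> \<le> \<bar>t\<bar> * (W * (C * (\<bar>t\<bar> * W)))"
    by (rule mult_left_mono) simp
  moreover have "\<bar>t\<bar> * (W * (C * (\<bar>t\<bar> * W))) = C * t\<^sup>2 * W\<^sup>2"
    by (simp add: power2_eq_square abs_mult[symmetric] algebra_simps)
  moreover have "F (x, \<lambda>a. v a + t * w a) - F (x, v) - t * g' 0 = t * (g' s - g' 0)"
    using s(2) by (simp add: algebra_simps)
  ultimately have "\<bar>F (x, \<lambda>a. v a + t * w a) - F (x, v) - t * g' 0\<bar> \<le> C * t\<^sup>2 * W\<^sup>2"
    by (simp add: abs_mult)
  then show ?thesis by (simp add: g'_def W_def)
qed

lemma hessian_norm_bounds_entries:
  fixes F :: "('p::finite, 'q::finite) jet \<Rightarrow> real"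
  assumes "a \<in> jidx n" "b \<in> jidx n" "x \<in> \<Omega>"
  shows "\<bar>pd jshift (U a) (pd jshift (U b) F) (x, v)\<bar> \<le> hessian_norm n \<Omega> F (x, v)"
proof -
  define H where "H a b = (pds_cl jshift (\<Omega> \<times> UNIV) [U a, U b] F (x, v))\<^sup>2" for a b
  have "H a b \<le> (\<Sum>b\<in>jidx n. H a b)"
    using assms by (intro member_le_sum) (auto simp: finite_jidx H_def)
  also have "\<dots> \<le> (\<Sum>a\<in>jidx n. \<Sum>b\<in>jidx n. H a b)"
    by (rule member_le_sum[of _ _ "\<lambda>a. \<Sum>b\<in>jidx n. H a b"])
      (use assms in \<open>auto simp: finite_jidx H_def intro!: sum_nonneg\<close>)
  finally have "H a b \<le> (\<Sum>a\<in>jidx n. \<Sum>b\<in>jidx n. H a b)" .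
  moreover have "H a b = (pd jshift (U a) (pd jshift (U b) F) (x, v))\<^sup>2"
    using assms(3) by (simp add: H_def pds_cl_def)
  ultimately show ?thesis
    unfolding hessian_norm_def H_def by (intro real_le_rsqrt) simp
qed

section \<open>Moderate and negligible nets\<close>

definition moderate_on :: "'z set \<Rightarrow> (real \<Rightarrow> 'z \<Rightarrow> real) \<Rightarrow> bool" where
  "moderate_on A f \<longleftrightarrow> (\<exists>N::nat. sup_bigo A f (\<lambda>\<epsilon>. (1 / \<epsilon>) ^ N))"

definition negligible_on :: "'z set \<Rightarrow> (real \<Rightarrow> 'z \<Rightarrow> real) \<Rightarrow> bool" where
  "negligible_on A f \<longleftrightarrow> (\<forall>m::nat. sup_bigo A f (\<lambda>\<epsilon>. \<epsilon> ^ m))"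

lemma eventually_unit_interval: "\<forall>\<^sub>F \<epsilon> in at_right 0. \<epsilon> \<in> {0<..1::real}"
  unfolding eventually_at_right_field by (intro exI[of _ 1]) auto

lemma sup_bigo_add:
  assumes "sup_bigo A f h" "sup_bigo A g h" shows "sup_bigo A (\<lambda>\<epsilon> z. f \<epsilon> z + g \<epsilon> z) h"
proof -
  obtain K K' where "\<forall>\<^sub>F \<epsilon> in at_right 0. \<forall>z\<in>A. \<bar>f \<epsilon> z\<bar> \<le> K * h \<epsilon>"
    "\<forall>\<^sub>F \<epsilon> in at_right 0. \<forall>z\<in>A. \<bar>g \<epsilon> z\<bar> \<le> K' * h \<epsilon>"
    using assms unfolding sup_bigo_def by blast
  then have "\<forall>\<^sub>F \<epsilon> in at_right 0. \<forall>z\<in>A. \<bar>f \<epsilon> z + g \<epsilon> z\<bar> \<le> (K + K') * h \<epsilon>"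
    by eventually_elim (fastforce simp: distrib_right)
  then show ?thesis unfolding sup_bigo_def by blast
qed

lemma sup_bigo_mult:
  assumes "sup_bigo A f h" "sup_bigo A g k"
  shows "sup_bigo A (\<lambda>\<epsilon> z. f \<epsilon> z * g \<epsilon> z) (\<lambda>\<epsilon>. h \<epsilon> * k \<epsilon>)"
proof -
  obtain K K' where "\<forall>\<^sub>F \<epsilon> in at_right 0. \<forall>z\<in>A. \<bar>f \<epsilon> z\<bar> \<le> K * h \<epsilon>"
    "\<forall>\<^sub>F \<epsilon> in at_right 0. \<forall>z\<in>A. \<bar>g \<epsilon> z\<bar> \<le> K' * k \<epsilon>"
    using assms unfolding sup_bigo_def by blast
  then have "\<forall>\<^sub>F \<epsilon> in at_right 0. \<forall>z\<in>A. \<bar>f \<epsilon> z * g \<epsilon> z\<bar> \<le> (K * K') * (h \<epsilon> * k \<epsilon>)"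
  proof eventually_elim
    case (elim \<epsilon>)
    show ?case
    proof
      fix z assume "z \<in> A"
      then have "\<bar>f \<epsilon> z\<bar> * \<bar>g \<epsilon> z\<bar> \<le> (K * h \<epsilon>) * (K' * k \<epsilon>)"
        using elim by (meson abs_ge_zero mult_mono order_trans)
      then show "\<bar>f \<epsilon> z * g \<epsilon> z\<bar> \<le> (K * K') * (h \<epsilon> * k \<epsilon>)" by (simp add: abs_mult mult_ac)
    qed
  qed
  then show ?thesis unfolding sup_bigo_def by blast
qed

text \<open>The comparison point may differ from \<open>z\<close>. This covers both restriction to a subset and composition
  with a map, in particular with a jet.\<close>

lemma sup_bigo_mono:
  assumes "sup_bigo A f h"
    and "\<And>\<epsilon> z. \<epsilon> \<in> {0<..1} \<Longrightarrow> z \<in> B \<Longrightarrow> \<exists>z'\<in>A. \<bar>g \<epsilon> z\<bar> \<le> \<bar>f \<epsilon> z'\<bar>"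
  shows "sup_bigo B g h"
proof -
  obtain K where "\<forall>\<^sub>F \<epsilon> in at_right 0. \<forall>z\<in>A. \<bar>f \<epsilon> z\<bar> \<le> K * h \<epsilon>"
    using assms(1) unfolding sup_bigo_def by blast
  with eventually_unit_interval have "\<forall>\<^sub>F \<epsilon> in at_right 0. \<forall>z\<in>B. \<bar>g \<epsilon> z\<bar> \<le> K * h \<epsilon>"
    by eventually_elim (meson assms(2) order_trans)
  then show ?thesis unfolding sup_bigo_def by blast
qed

lemma sup_bigo_weaken:
  assumes "sup_bigo A f h" "\<And>\<epsilon>. \<epsilon> \<in> {0<..1} \<Longrightarrow> \<bar>h \<epsilon>\<bar> \<le> k \<epsilon>"
  shows "sup_bigo A f k"
proof -
  obtain K where "\<forall>\<^sub>F \<epsilon> in at_right 0. \<forall>z\<in>A. \<bar>f \<epsilon> z\<bar> \<le> K * h \<epsilon>"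
    using assms(1) unfolding sup_bigo_def by blast
  with eventually_unit_interval have "\<forall>\<^sub>F \<epsilon> in at_right 0. \<forall>z\<in>A. \<bar>f \<epsilon> z\<bar> \<le> \<bar>K\<bar> * k \<epsilon>"
  proof eventually_elim
    case (elim \<epsilon>)
    have "K * h \<epsilon> \<le> \<bar>K\<bar> * \<bar>h \<epsilon>\<bar>" by (metis abs_ge_self abs_mult)
    also have "\<dots> \<le> \<bar>K\<bar> * k \<epsilon>" using assms(2) elim(1) by (intro mult_left_mono) auto
    finally show ?case using elim(2) by force
  qed
  then show ?thesis unfolding sup_bigo_def by blast
qed

lemma moderate_on_mono:
  assumes "moderate_on A f"
    and "\<And>\<epsilon> z. \<epsilon> \<in> {0<..1} \<Longrightarrow> z \<in> B \<Longrightarrow> \<exists>z'\<in>A. \<bar>g \<epsilon> z\<bar> \<le> \<bar>f \<epsilon> z'\<bar>"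
  shows "moderate_on B g"
proof -
  obtain N :: nat where "sup_bigo A f (\<lambda>\<epsilon>. (1 / \<epsilon>) ^ N)"
    using assms(1) unfolding moderate_on_def by (rule exE)
  from sup_bigo_mono[OF this assms(2)] show ?thesis
    unfolding moderate_on_def by (rule exI)
qed

lemma negligible_on_mono:
  assumes "negligible_on A f"
    and "\<And>\<epsilon> z. \<epsilon> \<in> {0<..1} \<Longrightarrow> z \<in> B \<Longrightarrow> \<exists>z'\<in>A. \<bar>g \<epsilon> z\<bar> \<le> \<bar>f \<epsilon> z'\<bar>"
  shows "negligible_on B g"
  unfolding negligible_on_def
  by (intro allI sup_bigo_mono[OF assms(1)[unfolded negligible_on_def, rule_format] assms(2)])

lemma one_over_power_mono:
  "\<epsilon> \<in> {0<..1} \<Longrightarrow> N \<le> M \<Longrightarrow> \<bar>(1 / \<epsilon>) ^ N\<bar> \<le> (1 / \<epsilon> :: real) ^ M"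
  by (simp add: power_increasing)

lemma moderate_on_add:
  assumes "moderate_on A f" "moderate_on A g" shows "moderate_on A (\<lambda>\<epsilon> z. f \<epsilon> z + g \<epsilon> z)"
proof -
  obtain N N' where N: "sup_bigo A f (\<lambda>\<epsilon>. (1 / \<epsilon>) ^ N)" "sup_bigo A g (\<lambda>\<epsilon>. (1 / \<epsilon>) ^ N')"
    using assms unfolding moderate_on_def by (elim exE)
  have "sup_bigo A f (\<lambda>\<epsilon>. (1 / \<epsilon>) ^ max N N')" "sup_bigo A g (\<lambda>\<epsilon>. (1 / \<epsilon>) ^ max N N')"
    by (rule sup_bigo_weaken[OF N(1)], rule one_over_power_mono, simp_all)
      (rule sup_bigo_weaken[OF N(2)], rule one_over_power_mono, simp_all)
  from sup_bigo_add[OF this] show ?thesis unfolding moderate_on_def by (rule exI)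
qed

lemma moderate_on_mult:
  assumes "moderate_on A f" "moderate_on A g" shows "moderate_on A (\<lambda>\<epsilon> z. f \<epsilon> z * g \<epsilon> z)"
proof -
  obtain N N' where "sup_bigo A f (\<lambda>\<epsilon>. (1 / \<epsilon>) ^ N)" "sup_bigo A g (\<lambda>\<epsilon>. (1 / \<epsilon>) ^ N')"
    using assms unfolding moderate_on_def by blast
  from sup_bigo_mult[OF this] show ?thesis
    unfolding moderate_on_def power_add[symmetric] by (rule exI)
qed

lemma moderate_on_bounded:
  assumes "\<And>\<epsilon> z. \<epsilon> \<in> {0<..1} \<Longrightarrow> z \<in> A \<Longrightarrow> \<bar>f \<epsilon> z\<bar> \<le> B" shows "moderate_on A f"
  unfolding moderate_on_def sup_bigo_def
proof (intro exI)
  show "\<forall>\<^sub>F \<epsilon> in at_right 0. \<forall>z\<in>A. \<bar>f \<epsilon> z\<bar> \<le> B * (1 / \<epsilon>) ^ 0"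
    using eventually_unit_interval by eventually_elim (use assms in auto)
qed

lemma moderate_on_sum:
  "(\<And>i. i \<in> I \<Longrightarrow> moderate_on A (f i)) \<Longrightarrow> moderate_on A (\<lambda>\<epsilon> z. \<Sum>i\<in>I. f i \<epsilon> z)"
  by (induction I rule: infinite_finite_induct)
    (simp_all add: moderate_on_add moderate_on_bounded[of _ _ 0])

lemma moderate_on_power:
  "moderate_on A f \<Longrightarrow> moderate_on A (\<lambda>\<epsilon> z. f \<epsilon> z ^ k)"
  by (induction k) (simp_all add: moderate_on_mult moderate_on_bounded[of _ _ 1])

lemma negligible_on_add:
  "negligible_on A f \<Longrightarrow> negligible_on A g \<Longrightarrow> negligible_on A (\<lambda>\<epsilon> z. f \<epsilon> z + g \<epsilon> z)"
  unfolding negligible_on_def by (simp add: sup_bigo_add)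

text \<open>To reach the order \<open>m\<close> against a factor \<open>1 / \<epsilon>\<close> to the power \<open>N\<close>, use negligibility at the order \<open>m + N\<close>.\<close>

lemma negligible_on_mult_moderate:
  assumes "negligible_on A f" "moderate_on A g" shows "negligible_on A (\<lambda>\<epsilon> z. f \<epsilon> z * g \<epsilon> z)"
  unfolding negligible_on_def
proof
  fix m :: nat
  obtain N where "sup_bigo A g (\<lambda>\<epsilon>. (1 / \<epsilon>) ^ N)" using assms(2) unfolding moderate_on_def by blast
  from sup_bigo_mult[OF assms(1)[unfolded negligible_on_def, rule_format, of "m + N"] this]
  show "sup_bigo A (\<lambda>\<epsilon> z. f \<epsilon> z * g \<epsilon> z) (\<lambda>\<epsilon>. \<epsilon> ^ m)"
    by (rule sup_bigo_weaken) (auto simp: power_add power_one_over field_simps)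
qed

lemma negligible_on_zero: "negligible_on A (\<lambda>\<epsilon> z. 0)"
  unfolding negligible_on_def sup_bigo_def by (intro allI exI[of _ 0]) simp

lemma negligible_on_sum:
  "(\<And>i. i \<in> I \<Longrightarrow> negligible_on A (f i)) \<Longrightarrow> negligible_on A (\<lambda>\<epsilon> z. \<Sum>i\<in>I. f i \<epsilon> z)"
  by (induction I rule: infinite_finite_induct)
    (simp_all add: negligible_on_add negligible_on_zero)

text \<open>For functions that are not integrable the integral is \<open>0\<close> by convention, so that the estimate
  persists.\<close>

lemma abs_set_integral_le:
  fixes f :: "'a::euclidean_space \<Rightarrow> real"
  assumes \<Omega>: "open \<Omega>" "bounded \<Omega>" and B: "\<And>x. x \<in> \<Omega> \<Longrightarrow> \<bar>f x\<bar> \<le> B" "0 \<le> B"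
  shows "\<bar>LINT x:\<Omega>|lborel. f x\<bar> \<le> B * measure lborel \<Omega>"
proof (cases "set_integrable lborel \<Omega> f")
  case True
  have fin: "emeasure lborel \<Omega> < \<infinity>" by (rule emeasure_bounded_finite[OF \<Omega>(2)])
  have "norm (LINT x|lborel. indicat_real \<Omega> x *\<^sub>R f x) \<le> (LINT x|lborel. indicat_real \<Omega> x * B)"
  proof (rule Bochner_Integration.integral_norm_bound_integral)
    show "integrable lborel (\<lambda>x. indicat_real \<Omega> x *\<^sub>R f x)"
      using True by (simp add: set_integrable_def)
    show "integrable lborel (\<lambda>x. indicat_real \<Omega> x * B)"
      using \<Omega>(1) fin by (intro integrable_mult_left integrable_real_indicator) auto
  qed (use B in \<open>auto simp: indicator_def\<close>)
  then show ?thesis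
    unfolding set_lebesgue_integral_def using \<Omega>(1) by (simp add: mult.commute)
next
  case False
  then show ?thesis
    unfolding set_lebesgue_integral_def set_integrable_def
    using B(2) by (simp add: not_integrable_integral_eq)
qed

lemma set_integrable_bounded_continuous:
  fixes f :: "'a::euclidean_space \<Rightarrow> real"
  assumes \<Omega>: "open \<Omega>" "bounded \<Omega>" and f: "continuous_on \<Omega> f" "\<And>x. x \<in> \<Omega> \<Longrightarrow> \<bar>f x\<bar> \<le> B"
  shows "set_integrable lborel \<Omega> f"
  unfolding set_integrable_def
proof (rule Bochner_Integration.integrable_bound)
  show "integrable lborel (\<lambda>x. indicat_real \<Omega> x * B)"
    using \<Omega>(1) emeasure_bounded_finite[OF \<Omega>(2)]
    by (intro integrable_mult_left integrable_real_indicator) auto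
  show "(\<lambda>x. indicat_real \<Omega> x *\<^sub>R f x) \<in> borel_measurable lborel"
    using borel_measurable_continuous_on_indicator[OF _ f(1)] \<Omega>(1) by simp
  show "AE x in lborel. norm (indicat_real \<Omega> x *\<^sub>R f x) \<le> norm (indicat_real \<Omega> x * B)"
    by (rule AE_I2) (use f(2) order_trans[OF f(2) abs_ge_self] in \<open>simp add: indicator_def\<close>)
qed

lemma negligible_on_integral:
  fixes f :: "real \<Rightarrow> 'a::euclidean_space \<Rightarrow> real"
  assumes \<Omega>: "open \<Omega>" "bounded \<Omega>" and f: "negligible_on \<Omega> f"
  shows "((\<lambda>\<epsilon>. LINT x:\<Omega>|lborel. f \<epsilon> x) \<longlongrightarrow> 0) (at_right 0)"
proof -
  obtain K where K: "\<forall>\<^sub>F \<epsilon> in at_right 0. \<forall>x\<in>\<Omega>. \<bar>f \<epsilon> x\<bar> \<le> K * \<epsilon> ^ 1"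
    using f[unfolded negligible_on_def, rule_format, of 1] unfolding sup_bigo_def by blast
  have "\<forall>\<^sub>F \<epsilon> in at_right 0. norm (LINT x:\<Omega>|lborel. f \<epsilon> x) \<le> \<bar>K\<bar> * \<epsilon> * measure lborel \<Omega>"
    using K eventually_unit_interval
  proof eventually_elim
    case (elim \<epsilon>)
    have "K * \<epsilon> \<le> \<bar>K\<bar> * \<epsilon>" using elim(2) by (intro mult_right_mono) auto
    then have "\<bar>f \<epsilon> x\<bar> \<le> \<bar>K\<bar> * \<epsilon>" if "x \<in> \<Omega>" for x
      using bspec[OF elim(1) that] by simp
    from abs_set_integral_le[OF \<Omega> this] show ?case using elim(2) by simp
  qed
  moreover have "((\<lambda>\<epsilon>. \<bar>K\<bar> * \<epsilon> * measure lborel \<Omega>) \<longlongrightarrow> 0) (at_right 0)"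
    by (rule tendsto_eq_intros refl | simp)+
  ultimately show ?thesis by (rule Lim_null_comparison)
qed

section \<open>Representatives\<close>

lemma (in coordinate_space) pds_diff:
  assumes "smooth_on sh C S f" "smooth_on sh C S g" "set cs \<subseteq> C" "z \<in> S"
  shows "pds sh cs (\<lambda>z. f z - g z) z = pds sh cs f z - pds sh cs g z"
  using pds_linear[OF assms, of 1 "-1"] by simp

text \<open>What the argument needs to know about a representative of an element of the Colombeau
  algebra, and about its translates by test functions.\<close>

definition moderate_family :: "(real ^ 'p) set \<Rightarrow> ('q \<Rightarrow> 'p::finite net) \<Rightarrow> bool" where
  "moderate_family \<Omega> v \<longleftrightarrow>
    (\<forall>\<alpha>. \<forall>\<epsilon>\<in>{0<..1}. smooth_on xshift UNIV \<Omega> (v \<alpha> \<epsilon>)) \<and>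
    (\<forall>\<alpha> cs. moderate_on \<Omega> (\<lambda>\<epsilon>. pds xshift cs (v \<alpha> \<epsilon>)))"

lemma moderate_family_smooth:
  "moderate_family \<Omega> v \<Longrightarrow> \<epsilon> \<in> {0<..1} \<Longrightarrow> smooth_on xshift UNIV \<Omega> (v \<alpha> \<epsilon>)"
  by (simp add: moderate_family_def)

lemma moderate_on_pds:
  assumes "u \<in> moderate \<Omega>" shows "moderate_on \<Omega> (\<lambda>\<epsilon>. pds xshift cs (u \<epsilon>))"
proof -
  have "moderate_on (closure \<Omega>) (\<lambda>\<epsilon>. pds_cl xshift \<Omega> cs (u \<epsilon>))"
    using assms unfolding moderate_def moderate_on_def by simp
  then show ?thesis
  proof (rule moderate_on_mono)
    fix \<epsilon> z assume "z \<in> \<Omega>"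
    then show "\<exists>z'\<in>closure \<Omega>. \<bar>pds xshift cs (u \<epsilon>) z\<bar> \<le> \<bar>pds_cl xshift \<Omega> cs (u \<epsilon>) z'\<bar>"
      using closure_subset by (intro bexI[of _ z]) (auto simp: pds_cl_def)
  qed
qed

lemma moderate_smooth:
  "u \<in> moderate \<Omega> \<Longrightarrow> \<epsilon> \<in> {0<..1} \<Longrightarrow> smooth_on xshift UNIV \<Omega> (u \<epsilon>)"
  by (simp add: moderate_def nets_def smooth_cl_def)

lemma moderate_family_of_moderate:
  "(\<And>\<alpha>. u \<alpha> \<in> moderate \<Omega>) \<Longrightarrow> moderate_family \<Omega> u"
  unfolding moderate_family_def by (simp add: moderate_on_pds moderate_smooth)

lemma moderate_family_translate:
  assumes op: "open \<Omega>" and u: "moderate_family \<Omega> u" and \<phi>: "\<phi> \<in> test_functions \<Omega>"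
  shows "moderate_family \<Omega> (\<lambda>\<alpha> \<epsilon> x. u \<alpha> \<epsilon> x + c \<alpha> * \<phi> x)"
proof -
  interpret coordinate_space xshift UNIV \<Omega> by (rule coordinate_space_xshift[OF op])
  note sm = test_function_smooth_on[OF \<phi>, of \<Omega>]
  show ?thesis
    unfolding moderate_family_def
  proof (intro conjI allI ballI)
    fix \<alpha> \<epsilon> assume "\<epsilon> \<in> {0<..1::real}"
    then show "smooth_on xshift UNIV \<Omega> (\<lambda>x. u \<alpha> \<epsilon> x + c \<alpha> * \<phi> x)"
      by (intro smooth_on_add smooth_on_mult smooth_on_const sm moderate_family_smooth[OF u])
  next
    fix \<alpha> cs
    obtain B where B: "\<And>x. \<bar>pds xshift cs \<phi> x\<bar> \<le> B"
      using test_function_bounded[OF test_function_pds[OF \<phi>]] by blast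
    have "moderate_on \<Omega> (\<lambda>\<epsilon> x. c \<alpha> * pds xshift cs \<phi> x)"
      by (rule moderate_on_bounded[of _ _ "\<bar>c \<alpha>\<bar> * B"]) (simp add: abs_mult mult_left_mono B)
    moreover have "moderate_on \<Omega> (\<lambda>\<epsilon>. pds xshift cs (u \<alpha> \<epsilon>))"
      using u by (simp add: moderate_family_def)
    ultimately have "moderate_on \<Omega> (\<lambda>\<epsilon> x. pds xshift cs (u \<alpha> \<epsilon>) x + c \<alpha> * pds xshift cs \<phi> x)"
      by (intro moderate_on_add)
    then show "moderate_on \<Omega> (\<lambda>\<epsilon>. pds xshift cs (\<lambda>x. u \<alpha> \<epsilon> x + c \<alpha> * \<phi> x))"
    proof (rule moderate_on_mono)
      fix \<epsilon> x assume "\<epsilon> \<in> {0<..1::real}" "x \<in> \<Omega>"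
      then have "pds xshift cs (\<lambda>x. u \<alpha> \<epsilon> x + c \<alpha> * \<phi> x) x = pds xshift cs (u \<alpha> \<epsilon>) x + c \<alpha> * pds xshift cs \<phi> x"
        using pds_linear[OF moderate_family_smooth[OF u] sm, where cs = cs and z = x and a = 1 and b = "c \<alpha>"]
        by simp
      then show "\<exists>y\<in>\<Omega>. \<bar>pds xshift cs (\<lambda>x. u \<alpha> \<epsilon> x + c \<alpha> * \<phi> x) x\<bar>
          \<le> \<bar>pds xshift cs (u \<alpha> \<epsilon>) y + c \<alpha> * pds xshift cs \<phi> y\<bar>"
        using \<open>x \<in> \<Omega>\<close> by (intro bexI[of _ x]) simp_all
    qed
  qed
qed

text \<open>Members of an equivalence class are both related to the member that generates it; comparing through that
  member avoids showing that the relation is transitive.\<close>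

lemma negligible_on_diff_of_common:
  assumes "negligible_on A (\<lambda>\<epsilon> z. f \<epsilon> z - g \<epsilon> z)" "negligible_on A (\<lambda>\<epsilon> z. f \<epsilon> z - h \<epsilon> z)"
  shows "negligible_on A (\<lambda>\<epsilon> z. g \<epsilon> z - h \<epsilon> z)"
proof -
  have "negligible_on A (\<lambda>\<epsilon> z. (f \<epsilon> z - g \<epsilon> z) * (-1))"
    by (rule negligible_on_mult_moderate[OF assms(1) moderate_on_bounded[of _ _ 1]]) simp
  from negligible_on_add[OF this assms(2)] show ?thesis by (simp add: algebra_simps)
qed

lemma colombeau_representatives:
  assumes op: "open \<Omega>" and K: "K \<in> colombeau \<Omega>" "v \<in> K" "w \<in> K"
  shows "v \<in> moderate \<Omega>" "negligible_on \<Omega> (\<lambda>\<epsilon> x. pds xshift cs (v \<epsilon>) x - pds xshift cs (w \<epsilon>) x)"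
proof -
  interpret coordinate_space xshift UNIV \<Omega> by (rule coordinate_space_xshift[OF op])
  obtain f where f: "f \<in> moderate \<Omega>" "K = {(u, v). u \<in> moderate \<Omega> \<and> v \<in> moderate \<Omega> \<and>
      (\<lambda>\<epsilon> x. u \<epsilon> x - v \<epsilon> x) \<in> negligible_nets \<Omega>} `` {f}"
    using K(1) unfolding colombeau_def by (rule quotientE)
  show "v \<in> moderate \<Omega>" using K(2) unfolding f(2) by simp
  have "negligible_on \<Omega> (\<lambda>\<epsilon> x. pds xshift cs (f \<epsilon>) x - pds xshift cs (g \<epsilon>) x)" if "g \<in> K" for g
  proof -
    have g: "g \<in> moderate \<Omega>" "(\<lambda>\<epsilon> x. f \<epsilon> x - g \<epsilon> x) \<in> negligible_nets \<Omega>"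
      using that unfolding f(2) by simp_all
    have "negligible_on (closure \<Omega>) (\<lambda>\<epsilon>. pds_cl xshift \<Omega> cs (\<lambda>x. f \<epsilon> x - g \<epsilon> x))"
      using g(2) unfolding negligible_nets_def negligible_on_def by simp
    then show ?thesis
    proof (rule negligible_on_mono)
      fix \<epsilon> x assume "\<epsilon> \<in> {0<..1::real}" "x \<in> \<Omega>"
      then show "\<exists>z'\<in>closure \<Omega>. \<bar>pds xshift cs (f \<epsilon>) x - pds xshift cs (g \<epsilon>) x\<bar>
          \<le> \<bar>pds_cl xshift \<Omega> cs (\<lambda>x. f \<epsilon> x - g \<epsilon> x) z'\<bar>"
        using pds_diff[OF moderate_smooth[OF f(1)] moderate_smooth[OF g(1)], of \<epsilon> \<epsilon> cs x] closure_subset[of \<Omega>]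
        by (intro bexI[of _ x]) (auto simp: pds_cl_def)
    qed
  qed
  from negligible_on_diff_of_common[OF this[OF K(2)] this[OF K(3)]]
  show "negligible_on \<Omega> (\<lambda>\<epsilon> x. pds xshift cs (v \<epsilon>) x - pds xshift cs (w \<epsilon>) x)" .
qed

lemma jnorm_nonneg: "0 \<le> jnorm n z"
  by (simp add: jnorm_def sum_nonneg)

lemma tempered_moderate_jets:
  assumes "L \<in> tempered_moderate n \<Omega>" "\<epsilon> \<in> {0<..1}"
  shows "on_jets n (L \<epsilon>)" "smooth_on jshift (jcoords n) (\<Omega> \<times> UNIV) (L \<epsilon>)"
  using assms by (auto simp: tempered_moderate_def jet_nets_def smooth_cl_def)

lemma tempered_moderate_smooth:
  assumes "open (\<Omega> :: (real ^ 'p::finite) set)"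
    and "(L :: ('p, 'q) jnet) \<in> tempered_moderate n \<Omega>" "\<epsilon> \<in> {0<..1}"
  shows "smooth_on jshift UNIV (\<Omega> \<times> UNIV) (L \<epsilon>)"
  by (rule smooth_on_all_jcoords[OF assms(1) tempered_moderate_jets[OF assms(2,3)]])

text \<open>The two differences from the generator of the class come with weights of different degree. Since a higher weight
  only makes a quotient smaller, the larger degree serves for both.\<close>

lemma tempered_representatives:
  fixes \<Omega> :: "(real ^ 'p::finite) set" and K :: "('p, 'q::finite) jnet set"
  assumes op: "open \<Omega>" and K: "K \<in> tempered n \<Omega>" "L \<in> K" "M \<in> K"
  shows "L \<in> tempered_moderate n \<Omega>"
    and "set b \<subseteq> jcoords n \<Longrightarrow> \<exists>l::nat. negligible_on (\<Omega> \<times> UNIV)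
      (\<lambda>\<epsilon> z. (pds jshift b (L \<epsilon>) z - pds jshift b (M \<epsilon>) z) / (1 + jnorm n z) ^ l)"
proof -
  interpret coordinate_space "jshift :: ('p, 'q) jcoord \<Rightarrow> _" "jcoords n" "\<Omega> \<times> UNIV"
    by (rule coordinate_space_jshift[OF op])
  obtain P where P: "P \<in> tempered_moderate n \<Omega>" "K = {(L, M). L \<in> tempered_moderate n \<Omega> \<and>
      M \<in> tempered_moderate n \<Omega> \<and> (\<lambda>\<epsilon> z. L \<epsilon> z - M \<epsilon> z) \<in> tempered_negligible n \<Omega>} `` {P}"
    using K(1) unfolding tempered_def by (rule quotientE)
  show "L \<in> tempered_moderate n \<Omega>" using K(2) unfolding P(2) by simp
  assume b: "set b \<subseteq> jcoords n"
  have "\<exists>l::nat. \<forall>k\<ge>l. negligible_on (\<Omega> \<times> UNIV)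
      (\<lambda>\<epsilon> z. pds jshift b (P \<epsilon>) z / (1 + jnorm n z) ^ k - pds jshift b (Q \<epsilon>) z / (1 + jnorm n z) ^ k)"
    if "Q \<in> K" for Q
  proof -
    have Q: "Q \<in> tempered_moderate n \<Omega>" "(\<lambda>\<epsilon> z. P \<epsilon> z - Q \<epsilon> z) \<in> tempered_negligible n \<Omega>"
      using that unfolding P(2) by simp_all
    obtain l :: nat where l: "negligible_on (closure \<Omega> \<times> UNIV)
        (\<lambda>\<epsilon> z. pds_cl jshift (\<Omega> \<times> UNIV) b (\<lambda>z. P \<epsilon> z - Q \<epsilon> z) z / (1 + jnorm n z) ^ l)"
      using Q(2) b unfolding tempered_negligible_def negligible_on_def by blast
    have "negligible_on (\<Omega> \<times> UNIV)
        (\<lambda>\<epsilon> z. pds jshift b (P \<epsilon>) z / (1 + jnorm n z) ^ k - pds jshift b (Q \<epsilon>) z / (1 + jnorm n z) ^ k)"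
      if k: "k \<ge> l" for k
    proof (rule negligible_on_mono[OF l])
      fix \<epsilon> and z :: "('p, 'q) jet" assume \<epsilon>: "\<epsilon> \<in> {0<..1::real}" and z: "z \<in> \<Omega> \<times> UNIV"
      have "pds_cl jshift (\<Omega> \<times> UNIV) b (\<lambda>z. P \<epsilon> z - Q \<epsilon> z) z = pds jshift b (P \<epsilon>) z - pds jshift b (Q \<epsilon>) z"
        using pds_diff[OF tempered_moderate_jets(2)[OF P(1) \<epsilon>] tempered_moderate_jets(2)[OF Q(1) \<epsilon>] b z] z
        by (simp add: pds_cl_def)
      moreover have "\<bar>d / (1 + jnorm n z) ^ k\<bar> \<le> \<bar>d / (1 + jnorm n z) ^ l\<bar>" for d
      proof -
        have "(1 + jnorm n z) ^ l \<le> (1 + jnorm n z) ^ k" "0 < (1 + jnorm n z) ^ l"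
          using k jnorm_nonneg[of n z] by (simp_all add: power_increasing)
        then show ?thesis by (simp add: abs_divide frac_le)
      qed
      moreover have "z \<in> closure \<Omega> \<times> UNIV" using z closure_subset[of \<Omega>] by auto
      ultimately show "\<exists>z'\<in>closure \<Omega> \<times> UNIV.
          \<bar>pds jshift b (P \<epsilon>) z / (1 + jnorm n z) ^ k - pds jshift b (Q \<epsilon>) z / (1 + jnorm n z) ^ k\<bar>
          \<le> \<bar>pds_cl jshift (\<Omega> \<times> UNIV) b (\<lambda>z. P \<epsilon> z - Q \<epsilon> z) z' / (1 + jnorm n z') ^ l\<bar>"
        by (intro bexI[of _ z]) (simp_all add: diff_divide_distrib[symmetric])
    qed
    then show ?thesis by blast
  qed
  from this[OF K(2)] this[OF K(3)] obtain l1 l2 :: nat where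
    l: "\<And>k. k \<ge> l1 \<Longrightarrow> negligible_on (\<Omega> \<times> UNIV)
      (\<lambda>\<epsilon> z. pds jshift b (P \<epsilon>) z / (1 + jnorm n z) ^ k - pds jshift b (L \<epsilon>) z / (1 + jnorm n z) ^ k)"
    "\<And>k. k \<ge> l2 \<Longrightarrow> negligible_on (\<Omega> \<times> UNIV)
      (\<lambda>\<epsilon> z. pds jshift b (P \<epsilon>) z / (1 + jnorm n z) ^ k - pds jshift b (M \<epsilon>) z / (1 + jnorm n z) ^ k)"
    by blast
  from negligible_on_diff_of_common[OF l(1)[OF max.cobounded1[of l1 l2]] l(2)[OF max.cobounded2[of l2 l1]]]
  show "\<exists>l::nat. negligible_on (\<Omega> \<times> UNIV)
      (\<lambda>\<epsilon> z. (pds jshift b (L \<epsilon>) z - pds jshift b (M \<epsilon>) z) / (1 + jnorm n z) ^ l)"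
    unfolding diff_divide_distrib by (rule exI)
qed

text \<open>Boundedness of \<open>\<Omega>\<close> enters here for the component \<open>x\<close> of the jet.\<close>

lemma moderate_on_jnorm:
  fixes v :: "'q::finite \<Rightarrow> 'p::finite net"
  assumes bd: "bounded \<Omega>" and v: "moderate_family \<Omega> v"
  shows "moderate_on \<Omega> (\<lambda>\<epsilon> x. 1 + jnorm n (jet (\<lambda>\<alpha>. v \<alpha> \<epsilon>) x))"
proof -
  obtain B where B: "\<And>x. x \<in> \<Omega> \<Longrightarrow> norm x \<le> B" using bd unfolding bounded_iff by blast
  define f where "f \<epsilon> x = (1 + B) + (\<Sum>a\<in>jidx n. \<bar>pds xshift (ordering (snd a)) (v (fst a) \<epsilon>) x\<bar>)" for \<epsilon> x
  have abs: "moderate_on \<Omega> (\<lambda>\<epsilon> x. \<bar>pds xshift cs (v \<alpha> \<epsilon>) x\<bar>)" for cs \<alpha>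
    by (rule moderate_on_mono[of \<Omega> "\<lambda>\<epsilon>. pds xshift cs (v \<alpha> \<epsilon>)"])
      (use v in \<open>simp add: moderate_family_def\<close>, intro bexI, simp_all)
  have "moderate_on \<Omega> f"
    unfolding f_def[abs_def]
    by (intro moderate_on_add moderate_on_sum abs moderate_on_bounded[of _ _ "\<bar>1 + B\<bar>"]) simp
  then show ?thesis
  proof (rule moderate_on_mono)
    fix \<epsilon> x assume x: "x \<in> \<Omega>"
    define s where "s = sqrt (\<Sum>a\<in>jidx n. (snd (jet (\<lambda>\<alpha>. v \<alpha> \<epsilon>) x) a)\<^sup>2)"
    have s2: "s\<^sup>2 = (\<Sum>a\<in>jidx n. (snd (jet (\<lambda>\<alpha>. v \<alpha> \<epsilon>) x) a)\<^sup>2)"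
      by (simp add: s_def sum_nonneg)
    have s0: "0 \<le> s" by (simp add: s_def sum_nonneg)
    have "jnorm n (jet (\<lambda>\<alpha>. v \<alpha> \<epsilon>) x) = sqrt ((norm x)\<^sup>2 + s\<^sup>2)"
      by (simp add: jnorm_def s2) (simp add: jet_def)
    also have "\<dots> \<le> \<bar>norm x\<bar> + \<bar>s\<bar>" by (rule sqrt_sum_squares_le_sum_abs)
    also have "\<dots> \<le> B + s" using B[OF x] s0 by simp
    also have "s \<le> (\<Sum>a\<in>jidx n. \<bar>snd (jet (\<lambda>\<alpha>. v \<alpha> \<epsilon>) x) a\<bar>)"
      unfolding s_def L2_set_def[symmetric] by (rule L2_set_le_sum_abs)
    also have "\<dots> = (\<Sum>a\<in>jidx n. \<bar>pds xshift (ordering (snd a)) (v (fst a) \<epsilon>) x\<bar>)"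
      by (simp add: jet_def split_def)
    finally have "1 + jnorm n (jet (\<lambda>\<alpha>. v \<alpha> \<epsilon>) x) \<le> f \<epsilon> x" by (simp add: f_def)
    then have "\<bar>1 + jnorm n (jet (\<lambda>\<alpha>. v \<alpha> \<epsilon>) x)\<bar> \<le> \<bar>f \<epsilon> x\<bar>"
      using jnorm_nonneg[of n "jet (\<lambda>\<alpha>. v \<alpha> \<epsilon>) x"] by linarith
    then show "\<exists>y\<in>\<Omega>. \<bar>1 + jnorm n (jet (\<lambda>\<alpha>. v \<alpha> \<epsilon>) x)\<bar> \<le> \<bar>f \<epsilon> y\<bar>" using x by blast
  qed
qed

text \<open>Composition with moderate jets: polynomial weights on jet space turn into powers of
  \<open>1 / \<epsilon>\<close>, which negligibility absorbs.\<close>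

lemma along_jets:
  fixes v :: "'q::finite \<Rightarrow> 'p::finite net" and f :: "real \<Rightarrow> ('p, 'q) jet \<Rightarrow> real"
  assumes bd: "bounded \<Omega>" and v: "moderate_family \<Omega> v"
  shows "moderate_on (\<Omega> \<times> UNIV) (\<lambda>\<epsilon> z. f \<epsilon> z / (1 + jnorm n z) ^ l) \<Longrightarrow>
      moderate_on \<Omega> (\<lambda>\<epsilon> x. f \<epsilon> (jet (\<lambda>\<alpha>. v \<alpha> \<epsilon>) x))" (is "?m1 \<Longrightarrow> ?m2")
    and "negligible_on (\<Omega> \<times> UNIV) (\<lambda>\<epsilon> z. f \<epsilon> z / (1 + jnorm n z) ^ l) \<Longrightarrow>
      negligible_on \<Omega> (\<lambda>\<epsilon> x. f \<epsilon> (jet (\<lambda>\<alpha>. v \<alpha> \<epsilon>) x))" (is "?n1 \<Longrightarrow> ?n2")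
proof -
  define J where "J \<epsilon> x = (jet (\<lambda>\<alpha>. v \<alpha> \<epsilon>) x :: ('p, 'q) jet)" for \<epsilon> x
  note weight = moderate_on_power[OF moderate_on_jnorm[OF bd v, of n], of l, folded J_def]
  have J: "\<exists>z\<in>\<Omega> \<times> UNIV. \<bar>f \<epsilon> (J \<epsilon> x) / (1 + jnorm n (J \<epsilon> x)) ^ l\<bar> \<le> \<bar>f \<epsilon> z / (1 + jnorm n z) ^ l\<bar>"
    if "x \<in> \<Omega>" for \<epsilon> x
    using that by (intro bexI[of _ "J \<epsilon> x"]) (simp_all add: J_def jet_def)
  have cancel: "f \<epsilon> (J \<epsilon> x) / (1 + jnorm n (J \<epsilon> x)) ^ l * (1 + jnorm n (J \<epsilon> x)) ^ l = f \<epsilon> (J \<epsilon> x)" for \<epsilon> x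
    using jnorm_nonneg[of n "J \<epsilon> x"] by (simp add: add_nonneg_eq_0_iff)
  show ?m2 if ?m1
  proof -
    have "moderate_on \<Omega> (\<lambda>\<epsilon> x. f \<epsilon> (J \<epsilon> x) / (1 + jnorm n (J \<epsilon> x)) ^ l)"
      by (rule moderate_on_mono[OF that J])
    from moderate_on_mult[OF this weight] show ?thesis unfolding cancel unfolding J_def .
  qed
  show ?n2 if ?n1
  proof -
    have "negligible_on \<Omega> (\<lambda>\<epsilon> x. f \<epsilon> (J \<epsilon> x) / (1 + jnorm n (J \<epsilon> x)) ^ l)"
      by (rule negligible_on_mono[OF that J])
    from negligible_on_mult_moderate[OF this weight] show ?thesis unfolding cancel unfolding J_def .
  qed
qed

lemma tempered_moderate_along_jet:
  fixes v :: "'q::finite \<Rightarrow> 'p::finite net"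
  assumes bd: "bounded \<Omega>" and v: "moderate_family \<Omega> v" and L: "L \<in> tempered_moderate n \<Omega>"
  shows "moderate_on \<Omega> (\<lambda>\<epsilon> x. L \<epsilon> (jet (\<lambda>\<alpha>. v \<alpha> \<epsilon>) x))"
proof -
  obtain N :: nat where N: "sup_bigo (closure \<Omega> \<times> UNIV)
      (\<lambda>\<epsilon> z. pds_cl jshift (\<Omega> \<times> UNIV) [] (L \<epsilon>) z / (1 + jnorm n z) ^ N) (\<lambda>\<epsilon>. (1 / \<epsilon>) ^ N)"
    using L unfolding tempered_moderate_def by fastforce
  have "moderate_on (closure \<Omega> \<times> UNIV) (\<lambda>\<epsilon> z. pds_cl jshift (\<Omega> \<times> UNIV) [] (L \<epsilon>) z / (1 + jnorm n z) ^ N)"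
    unfolding moderate_on_def using N by (rule exI)
  then have "moderate_on (\<Omega> \<times> UNIV) (\<lambda>\<epsilon> z. L \<epsilon> z / (1 + jnorm n z) ^ N)"
  proof (rule moderate_on_mono)
    fix \<epsilon> and z :: "('p, 'q) jet" assume "z \<in> \<Omega> \<times> UNIV"
    then show "\<exists>z'\<in>closure \<Omega> \<times> UNIV. \<bar>L \<epsilon> z / (1 + jnorm n z) ^ N\<bar>
        \<le> \<bar>pds_cl jshift (\<Omega> \<times> UNIV) [] (L \<epsilon>) z' / (1 + jnorm n z') ^ N\<bar>"
      using closure_subset[of \<Omega>] by (intro bexI[of _ z]) (auto simp: pds_cl_def)
  qed
  then show ?thesis by (rule along_jets(1)[OF bd v])
qed

lemma tempered_difference_along_jet:
  fixes v :: "'q::finite \<Rightarrow> 'p::finite net"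
  assumes op: "open \<Omega>" and bd: "bounded \<Omega>" and v: "moderate_family \<Omega> v"
    and K: "K \<in> tempered n \<Omega>" "L \<in> K" "M \<in> K" and b: "set b \<subseteq> jcoords n"
  shows "negligible_on \<Omega> (\<lambda>\<epsilon> x. pds jshift b (L \<epsilon>) (jet (\<lambda>\<alpha>. v \<alpha> \<epsilon>) x) -
    pds jshift b (M \<epsilon>) (jet (\<lambda>\<alpha>. v \<alpha> \<epsilon>) x))"
proof -
  obtain l where "negligible_on (\<Omega> \<times> UNIV)
      (\<lambda>\<epsilon> z. (pds jshift b (L \<epsilon>) z - pds jshift b (M \<epsilon>) z) / (1 + jnorm n z) ^ l)"
    using tempered_representatives(2)[OF op K b] by (rule exE)
  then show ?thesis by (rule along_jets(2)[OF bd v])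
qed

section \<open>The first variation\<close>

text \<open>The weak form of \<open>E\<^sub>\<alpha>(F)(u)\<close> tested with \<open>\<phi>\<close>, which is also the derivative at \<open>t = 0\<close> of the functional at
  \<open>u + t\<phi>\<close>, with \<open>t\<phi>\<close> added to the component \<open>\<alpha>\<close>.\<close>

definition first_variation ::
  "nat \<Rightarrow> (real ^ 'p) set \<Rightarrow> 'q \<Rightarrow> (real ^ 'p \<Rightarrow> real) \<Rightarrow> (('p::finite, 'q) jet \<Rightarrow> real) \<Rightarrow>
    ('q \<Rightarrow> real ^ 'p \<Rightarrow> real) \<Rightarrow> real" where
  "first_variation n \<Omega> \<alpha> \<phi> F u =
    (LINT x:\<Omega>|lborel. \<Sum>J | size J \<le> n. pd jshift (U (\<alpha>, J)) F (jet u x) * pds xshift (ordering J) \<phi> x)"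

lemma set_integrable_first_variation:
  fixes F :: "('p::finite, 'q::finite) jet \<Rightarrow> real"
  assumes op: "open \<Omega>" and F: "smooth_on jshift UNIV (\<Omega> \<times> UNIV) F"
    and u: "\<And>\<alpha>. smooth_on xshift UNIV \<Omega> (u \<alpha>)" and \<phi>: "\<phi> \<in> test_functions \<Omega>"
  shows "set_integrable lborel \<Omega>
    (\<lambda>x. \<Sum>J | size J \<le> n. pd jshift (U (\<alpha>, J)) F (jet u x) * pds xshift (ordering J) \<phi> x)"
proof -
  have "set_integrable lborel \<Omega> (\<lambda>x. pd jshift (U (\<alpha>, J)) F (jet u x) * pds xshift (ordering J) \<phi> x)" for J
    by (rule set_integrable_times_test_function[OF op
          continuous_on_along_jet[OF smooth_on_pd[OF F UNIV_I] u] test_function_pds[OF \<phi>]])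
  then show ?thesis
    unfolding set_integrable_def scaleR_sum_right by (rule Bochner_Integration.integrable_sum)
qed

text \<open>The increments of the functional are differences of integrals. To combine them into one integral each term must be
  integrable, which moderateness provides for small \<open>\<epsilon>\<close>.\<close>

lemma eventually_set_integrable_along_jet:
  fixes v :: "'q::finite \<Rightarrow> 'p::finite net"
  assumes \<Omega>: "open \<Omega>" "bounded \<Omega>" and v: "moderate_family \<Omega> v" and L: "L \<in> tempered_moderate n \<Omega>"
  shows "\<forall>\<^sub>F \<epsilon> in at_right 0. set_integrable lborel \<Omega> (\<lambda>x. L \<epsilon> (jet (\<lambda>\<alpha>. v \<alpha> \<epsilon>) x))"
proof -
  obtain N K where "\<forall>\<^sub>F \<epsilon> in at_right 0. \<forall>x\<in>\<Omega>. \<bar>L \<epsilon> (jet (\<lambda>\<alpha>. v \<alpha> \<epsilon>) x)\<bar> \<le> K * (1 / \<epsilon>) ^ N"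
    using tempered_moderate_along_jet[OF \<Omega>(2) v L] unfolding moderate_on_def sup_bigo_def by (elim exE)
  then show ?thesis
    using eventually_unit_interval
  proof eventually_elim
    case (elim \<epsilon>)
    have "continuous_on \<Omega> (\<lambda>x. L \<epsilon> (jet (\<lambda>\<alpha>. v \<alpha> \<epsilon>) x))"
      by (rule continuous_on_along_jet[OF tempered_moderate_smooth[OF \<Omega>(1) L elim(2)]
            moderate_family_smooth[OF v elim(2)]])
    then show ?case
      by (rule set_integrable_bounded_continuous[OF \<Omega>]) (rule bspec[OF elim(1)])
  qed
qed

text \<open>The difference of the Lagrangians is negligible along moderate jets, and \<open>\<Omega>\<close> has finite measure.\<close>

lemma functional_independent_of_representative:
  fixes v :: "'q::finite \<Rightarrow> 'p::finite net"
  assumes \<Omega>: "open \<Omega>" "bounded \<Omega>" and v: "moderate_family \<Omega> v"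
    and K: "K \<in> tempered n \<Omega>" "L \<in> K" "M \<in> K"
  shows "((\<lambda>\<epsilon>. functional \<Omega> (L \<epsilon>) (\<lambda>\<alpha>. v \<alpha> \<epsilon>) - functional \<Omega> (M \<epsilon>) (\<lambda>\<alpha>. v \<alpha> \<epsilon>)) \<longlongrightarrow> 0) (at_right 0)"
proof (rule Lim_transform_eventually)
  show "((\<lambda>\<epsilon>. LINT x:\<Omega>|lborel. L \<epsilon> (jet (\<lambda>\<alpha>. v \<alpha> \<epsilon>) x) - M \<epsilon> (jet (\<lambda>\<alpha>. v \<alpha> \<epsilon>) x)) \<longlongrightarrow> 0) (at_right 0)"
    using tempered_difference_along_jet[OF \<Omega> v K, of "[]"]
    by (intro negligible_on_integral[OF \<Omega>]) simp
  show "\<forall>\<^sub>F \<epsilon> in at_right 0. (LINT x:\<Omega>|lborel. L \<epsilon> (jet (\<lambda>\<alpha>. v \<alpha> \<epsilon>) x) - M \<epsilon> (jet (\<lambda>\<alpha>. v \<alpha> \<epsilon>) x)) =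
      functional \<Omega> (L \<epsilon>) (\<lambda>\<alpha>. v \<alpha> \<epsilon>) - functional \<Omega> (M \<epsilon>) (\<lambda>\<alpha>. v \<alpha> \<epsilon>)"
    using eventually_set_integrable_along_jet[OF \<Omega> v tempered_representatives(1)[OF \<Omega>(1) K(1) K(2) K(2)]]
      eventually_set_integrable_along_jet[OF \<Omega> v tempered_representatives(1)[OF \<Omega>(1) K(1) K(3) K(3)]]
    by eventually_elim (simp add: functional_def set_integral_diff)
qed

text \<open>For a variation of the component \<open>\<alpha>\<close> alone, the differential of the Lagrangian, a sum over all jet
  coordinates, reduces to a sum over multi-indices.\<close>

lemma sum_jidx_single:
  fixes f :: "'p::finite multiset \<Rightarrow> real"
  shows "(\<Sum>a\<in>jidx n. (if fst a = (\<alpha> :: 'q::finite) then f (snd a) else 0)) = (\<Sum>J | size J \<le> n. f J)"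
proof -
  have "(\<Sum>a\<in>jidx n. (if fst a = \<alpha> then f (snd a) else 0)) =
      (\<Sum>a\<in>Pair \<alpha> ` {J. size J \<le> n}. (if fst a = \<alpha> then f (snd a) else 0))"
    by (rule sum.mono_neutral_right[OF finite_jidx]) (auto simp: jidx_def)
  also have "\<dots> = (\<Sum>J | size J \<le> n. f J)"
    by (subst sum.reindex) (auto simp: inj_on_def)
  finally show ?thesis .
qed

text \<open>The second order Taylor estimate, integrated over \<open>\<Omega>\<close>. Its constant is independent of
  \<open>\<epsilon>\<close>, since neither the bound on the Hessian nor the test function depends on it.\<close>

lemma functional_increment_estimate:
  fixes u :: "'q::finite \<Rightarrow> 'p::finite net"
  assumes \<Omega>: "open \<Omega>" "bounded \<Omega>" and u: "moderate_family \<Omega> u" and L: "L \<in> tempered_moderate n \<Omega>"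
    and hess: "\<And>\<epsilon> z. \<epsilon> \<in> {0<..1} \<Longrightarrow> z \<in> \<Omega> \<times> UNIV \<Longrightarrow> hessian_norm n \<Omega> (L \<epsilon>) z \<le> C"
    and \<phi>: "\<phi> \<in> test_functions \<Omega>"
  obtains M where "0 \<le> M" and "\<And>t. \<forall>\<^sub>F \<epsilon> in at_right 0.
    \<bar>functional \<Omega> (L \<epsilon>) (\<lambda>\<beta> x. u \<beta> \<epsilon> x + (if \<beta> = \<alpha> then t else 0) * \<phi> x) - functional \<Omega> (L \<epsilon>) (\<lambda>\<beta>. u \<beta> \<epsilon>)
      - t * first_variation n \<Omega> \<alpha> \<phi> (L \<epsilon>) (\<lambda>\<beta>. u \<beta> \<epsilon>)\<bar> \<le> M * t\<^sup>2"
proof -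
  interpret coordinate_space xshift UNIV \<Omega> by (rule coordinate_space_xshift[OF \<Omega>(1)])
  define w where "w x a = (if fst a = \<alpha> then pds xshift (ordering (snd a)) \<phi> x else 0)" for x and a :: "'q \<times> 'p multiset"
  have "\<forall>J :: 'p multiset. \<exists>B. \<forall>x. \<bar>pds xshift (ordering J) \<phi> x\<bar> \<le> B"
    using test_function_bounded[OF test_function_pds[OF \<phi>]] by metis
  then obtain B where B: "\<And>(J :: 'p multiset) x. \<bar>pds xshift (ordering J) \<phi> x\<bar> \<le> B J" by metis
  define W where "W = (\<Sum>a\<in>jidx n. \<bar>B (snd (a :: 'q \<times> 'p multiset))\<bar>)"
  have W: "(\<Sum>a\<in>jidx n. \<bar>w x a\<bar>) \<le> W" for x
    unfolding W_def
  proof (rule sum_mono)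
    fix a :: "'q \<times> 'p multiset"
    show "\<bar>w x a\<bar> \<le> \<bar>B (snd a)\<bar>"
      using order_trans[OF B[where J = "snd a" and x = x] abs_ge_self] by (simp add: w_def)
  qed
  \<comment> \<open>\<open>C\<close> itself could be negative when \<open>\<Omega>\<close> is empty.\<close>
  define C' where "C' = max C 0"
  define M where "M = C' * W\<^sup>2 * measure lborel \<Omega>"
  have "0 \<le> M" by (simp add: M_def C'_def)
  moreover have "\<forall>\<^sub>F \<epsilon> in at_right 0.
    \<bar>functional \<Omega> (L \<epsilon>) (\<lambda>\<beta> x. u \<beta> \<epsilon> x + (if \<beta> = \<alpha> then t else 0) * \<phi> x) - functional \<Omega> (L \<epsilon>) (\<lambda>\<beta>. u \<beta> \<epsilon>)
      - t * first_variation n \<Omega> \<alpha> \<phi> (L \<epsilon>) (\<lambda>\<beta>. u \<beta> \<epsilon>)\<bar> \<le> M * t\<^sup>2" for t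
  proof -
    define v where "v \<beta> \<epsilon> = (\<lambda>x. u \<beta> \<epsilon> x + (if \<beta> = \<alpha> then t else 0) * \<phi> x)" for \<beta> \<epsilon>
    have v: "moderate_family \<Omega> v"
      unfolding v_def[abs_def] by (rule moderate_family_translate[OF \<Omega>(1) u \<phi>])
    show ?thesis
      using eventually_set_integrable_along_jet[OF \<Omega> v L] eventually_set_integrable_along_jet[OF \<Omega> u L]
        eventually_unit_interval
    proof eventually_elim
      case (elim \<epsilon>)
      note us = moderate_family_smooth[OF u elim(3)]
      note F = tempered_moderate_jets(1)[OF L elim(3)] tempered_moderate_smooth[OF \<Omega>(1) L elim(3)]
      define DF where "DF x = (\<Sum>J | size J \<le> n. pd jshift (U (\<alpha>, J)) (L \<epsilon>) (jet (\<lambda>\<beta>. u \<beta> \<epsilon>) x) * pds xshift (ordering J) \<phi> x)" for x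
      have DF: "set_integrable lborel \<Omega> DF"
        unfolding DF_def[abs_def] by (rule set_integrable_first_variation[OF \<Omega>(1) F(2) us \<phi>])
      have "\<bar>L \<epsilon> (jet (\<lambda>\<beta>. v \<beta> \<epsilon>) x) - L \<epsilon> (jet (\<lambda>\<beta>. u \<beta> \<epsilon>) x) - t * DF x\<bar> \<le> C' * t\<^sup>2 * W\<^sup>2" if x: "x \<in> \<Omega>" for x
      proof -
        define y where "y = snd (jet (\<lambda>\<beta>. u \<beta> \<epsilon>) x)"
        have ju: "jet (\<lambda>\<beta>. u \<beta> \<epsilon>) x = (x, y)" by (simp add: y_def jet_def)
        have "snd (jet (\<lambda>\<beta>. v \<beta> \<epsilon>) x) (\<beta>, J) = y (\<beta>, J) + t * w x (\<beta>, J)" for \<beta> J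
          using pds_linear[OF us test_function_smooth_on[OF \<phi>], where cs = "ordering J" and z = x and a = 1
              and b = "if \<beta> = \<alpha> then t else 0"] x
          by (simp add: jet_def y_def v_def w_def)
        then have jv: "jet (\<lambda>\<beta>. v \<beta> \<epsilon>) x = (x, \<lambda>a. y a + t * w x a)"
          by (auto simp: jet_def)
        have "DF x = (\<Sum>a\<in>jidx n. if fst a = \<alpha> then pd jshift (U (\<alpha>, snd a)) (L \<epsilon>) (x, y) * pds xshift (ordering (snd a)) \<phi> x else 0)"
          unfolding DF_def ju by (rule sum_jidx_single[symmetric])
        also have "\<dots> = (\<Sum>a\<in>jidx n. w x a * pd jshift (U a) (L \<epsilon>) (x, y))"
          by (rule sum.cong[OF refl]) (auto simp: w_def)
        finally have DFx: "DF x = \<dots>" .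
        have "\<bar>pd jshift (U a) (pd jshift (U b) (L \<epsilon>)) (x, v)\<bar> \<le> C'" if "a \<in> jidx n" "b \<in> jidx n" for a b v
          using hessian_norm_bounds_entries[OF that x, of "L \<epsilon>" v] hess[OF elim(3), of "(x, v)"] x
          by (simp add: C'_def)
        from jet_taylor[OF \<Omega>(1) F x this, of y t "w x"]
        have "\<bar>L \<epsilon> (jet (\<lambda>\<beta>. v \<beta> \<epsilon>) x) - L \<epsilon> (jet (\<lambda>\<beta>. u \<beta> \<epsilon>) x) - t * DF x\<bar>
            \<le> C' * t\<^sup>2 * (\<Sum>a\<in>jidx n. \<bar>w x a\<bar>)\<^sup>2"
          unfolding ju jv DFx by (simp add: C'_def)
        also have "\<dots> \<le> C' * t\<^sup>2 * W\<^sup>2"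
          by (intro mult_left_mono power_mono W sum_nonneg) (simp_all add: C'_def)
        finally show ?thesis .
      qed
      from abs_set_integral_le[OF \<Omega> this]
      have "\<bar>LINT x:\<Omega>|lborel. L \<epsilon> (jet (\<lambda>\<beta>. v \<beta> \<epsilon>) x) - L \<epsilon> (jet (\<lambda>\<beta>. u \<beta> \<epsilon>) x) - t * DF x\<bar> \<le> M * t\<^sup>2"
        by (simp add: M_def C'_def mult_ac)
      moreover have "(LINT x:\<Omega>|lborel. L \<epsilon> (jet (\<lambda>\<beta>. v \<beta> \<epsilon>) x) - L \<epsilon> (jet (\<lambda>\<beta>. u \<beta> \<epsilon>) x) - t * DF x) =
          functional \<Omega> (L \<epsilon>) (\<lambda>\<beta>. v \<beta> \<epsilon>) - functional \<Omega> (L \<epsilon>) (\<lambda>\<beta>. u \<beta> \<epsilon>)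
            - t * first_variation n \<Omega> \<alpha> \<phi> (L \<epsilon>) (\<lambda>\<beta>. u \<beta> \<epsilon>)"
        unfolding functional_def first_variation_def DF_def[symmetric]
        using elim(1,2) DF by (simp add: set_integral_diff(1,2))
      ultimately show ?case by (simp only: v_def)
    qed
  qed
  ultimately show ?thesis by (rule that)
qed

text \<open>Dividing by small positive and small negative \<open>t\<close> squeezes the first variation.\<close>

lemma first_order_condition:
  fixes F :: "real \<Rightarrow> 'a \<Rightarrow> real"
  assumes lim: "\<And>t. \<exists>l\<ge>0. (F t \<longlongrightarrow> l) net"
    and est: "\<And>t. \<forall>\<^sub>F \<epsilon> in net. \<bar>F t \<epsilon> - t * I \<epsilon>\<bar> \<le> M * t\<^sup>2" and M: "0 \<le> M"
  shows "(I \<longlongrightarrow> 0) net"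
proof (rule tendstoI)
  fix e :: real assume e: "0 < e"
  \<comment> \<open>The limit of \<open>F t\<close> is only nonnegative, so \<open>F t\<close> is bounded below by \<open>- t\<^sup>2\<close>; this slack accounts for \<open>M + 1\<close>.\<close>
  define t where "t = e / (2 * (M + 1))"
  have t: "0 < t" and tM: "(M + 1) * t < e"
    using e M by (simp_all add: t_def field_simps add_pos_nonneg)
  have lower: "\<forall>\<^sub>F \<epsilon> in net. - (s\<^sup>2) < F s \<epsilon>" if "s \<noteq> 0" for s
  proof -
    obtain l where "0 \<le> l" "(F s \<longlongrightarrow> l) net" using lim by blast
    moreover have "- (s\<^sup>2) < 0" using that by simp
    ultimately show ?thesis using order_tendstoD(1) less_le_trans by blast
  qed
  have "\<forall>\<^sub>F \<epsilon> in net. - (t\<^sup>2) < F t \<epsilon>" "\<forall>\<^sub>F \<epsilon> in net. - ((- t)\<^sup>2) < F (- t) \<epsilon>"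
    using lower[of t] lower[of "- t"] t by simp_all
  then show "\<forall>\<^sub>F \<epsilon> in net. dist (I \<epsilon>) 0 < e"
    using est[of t] est[of "- t"]
  proof eventually_elim
    case (elim \<epsilon>)
    have "- (t * ((M + 1) * t)) < t * I \<epsilon>" "t * I \<epsilon> < t * ((M + 1) * t)"
      using elim by (simp_all add: power2_eq_square algebra_simps abs_le_iff)
    then have "t * - ((M + 1) * t) < t * I \<epsilon>" "t * I \<epsilon> < t * ((M + 1) * t)" by simp_all
    then have "- ((M + 1) * t) < I \<epsilon>" "I \<epsilon> < (M + 1) * t"
      using t mult_less_cancel_left_pos by blast+
    then show ?case using tM by (simp add: dist_real_def)
  qed
qed

text \<open>Replacing the family changes the derivatives of the Lagrangian by a Lipschitz estimate,
  replacing the Lagrangian changes them by a negligible amount along moderate jets.\<close>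

lemma first_variation_independent_of_representatives:
  fixes u v :: "'q::finite \<Rightarrow> 'p::finite net"
  assumes \<Omega>: "open \<Omega>" "bounded \<Omega>" and u: "moderate_family \<Omega> u" and v: "moderate_family \<Omega> v"
    and uv: "\<And>\<beta> cs. negligible_on \<Omega> (\<lambda>\<epsilon> x. pds xshift cs (u \<beta> \<epsilon>) x - pds xshift cs (v \<beta> \<epsilon>) x)"
    and K: "K \<in> tempered n \<Omega>" "L \<in> K" "M \<in> K"
    and hess: "\<And>\<epsilon> z. \<epsilon> \<in> {0<..1} \<Longrightarrow> z \<in> \<Omega> \<times> UNIV \<Longrightarrow> hessian_norm n \<Omega> (L \<epsilon>) z \<le> C"
    and \<phi>: "\<phi> \<in> test_functions \<Omega>"
  shows "((\<lambda>\<epsilon>. first_variation n \<Omega> \<alpha> \<phi> (L \<epsilon>) (\<lambda>\<beta>. u \<beta> \<epsilon>) -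
    first_variation n \<Omega> \<alpha> \<phi> (M \<epsilon>) (\<lambda>\<beta>. v \<beta> \<epsilon>)) \<longlongrightarrow> 0) (at_right 0)"
proof -
  note L = tempered_representatives(1)[OF \<Omega>(1) K(1) K(2) K(2)]
  note M = tempered_representatives(1)[OF \<Omega>(1) K(1) K(3) K(3)]
  define DL where "DL J \<epsilon> x = pd jshift (U (\<alpha>, J)) (L \<epsilon>) (jet (\<lambda>\<beta>. u \<beta> \<epsilon>) x)" for J \<epsilon> x
  define DL' where "DL' J \<epsilon> x = pd jshift (U (\<alpha>, J)) (L \<epsilon>) (jet (\<lambda>\<beta>. v \<beta> \<epsilon>) x)" for J \<epsilon> x
  define DM where "DM J \<epsilon> x = pd jshift (U (\<alpha>, J)) (M \<epsilon>) (jet (\<lambda>\<beta>. v \<beta> \<epsilon>) x)" for J \<epsilon> x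
  have negl: "negligible_on \<Omega> (\<lambda>\<epsilon> x. (DL J \<epsilon> x - DM J \<epsilon> x) * pds xshift (ordering J) \<phi> x)"
    if J: "size J \<le> n" for J
  proof -
    define g where "g \<epsilon> x = (\<Sum>a\<in>jidx n. \<bar>pds xshift (ordering (snd a)) (u (fst a) \<epsilon>) x
      - pds xshift (ordering (snd a)) (v (fst a) \<epsilon>) x\<bar>)" for \<epsilon> x
    have "negligible_on \<Omega> g"
      unfolding g_def[abs_def]
    proof (rule negligible_on_sum)
      fix a :: "'q \<times> 'p multiset"
      show "negligible_on \<Omega> (\<lambda>\<epsilon> x. \<bar>pds xshift (ordering (snd a)) (u (fst a) \<epsilon>) x
          - pds xshift (ordering (snd a)) (v (fst a) \<epsilon>) x\<bar>)"
        by (rule negligible_on_mono[OF uv[of "ordering (snd a)" "fst a"]], rule bexI) simp_all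
    qed
    from negligible_on_mult_moderate[OF this moderate_on_bounded[of \<Omega> "\<lambda>_ _. max C 0" "max C 0"]]
    have "negligible_on \<Omega> (\<lambda>\<epsilon> x. g \<epsilon> x * max C 0)" by simp
    then have 1: "negligible_on \<Omega> (\<lambda>\<epsilon> x. DL J \<epsilon> x - DL' J \<epsilon> x)"
    proof (rule negligible_on_mono)
      fix \<epsilon> x assume \<epsilon>: "\<epsilon> \<in> {0<..1::real}" and x: "x \<in> \<Omega>"
      note F = tempered_moderate_jets(1)[OF L \<epsilon>] tempered_moderate_smooth[OF \<Omega>(1) L \<epsilon>]
      define y where "y = snd (jet (\<lambda>\<beta>. u \<beta> \<epsilon>) x)"
      define y' where "y' = snd (jet (\<lambda>\<beta>. v \<beta> \<epsilon>) x)"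
      have "\<bar>pd jshift (U a) (pd jshift (U (\<alpha>, J)) (L \<epsilon>)) (x, v)\<bar> \<le> max C 0" if "a \<in> jidx n" for a v
        using hessian_norm_bounds_entries[OF that _ x, of "(\<alpha>, J)" "L \<epsilon>" v] J hess[OF \<epsilon>, of "(x, v)"] x
        by (simp add: jidx_def)
      from jet_lipschitz[OF \<Omega>(1) on_jets_pd[OF F(1)] smooth_on_pd[OF F(2) UNIV_I] x this, where v = y and w = y']
      have "\<bar>DL J \<epsilon> x - DL' J \<epsilon> x\<bar> \<le> max C 0 * (\<Sum>a\<in>jidx n. \<bar>y a - y' a\<bar>)"
        by (simp add: DL_def DL'_def y_def y'_def jet_def)
      also have "(\<Sum>a\<in>jidx n. \<bar>y a - y' a\<bar>) = g \<epsilon> x"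
        by (simp add: g_def y_def y'_def jet_def split_def)
      finally have "\<bar>DL J \<epsilon> x - DL' J \<epsilon> x\<bar> \<le> \<bar>g \<epsilon> x * max C 0\<bar>"
        by (metis abs_ge_self mult.commute order_trans)
      then show "\<exists>z\<in>\<Omega>. \<bar>DL J \<epsilon> x - DL' J \<epsilon> x\<bar> \<le> \<bar>g \<epsilon> z * max C 0\<bar>"
        using x by (rule bexI)
    qed
    have 2: "negligible_on \<Omega> (\<lambda>\<epsilon> x. DL' J \<epsilon> x - DM J \<epsilon> x)"
      using tempered_difference_along_jet[OF \<Omega> v K, of "[U (\<alpha>, J)]"] J
      by (simp add: DL'_def DM_def jcoords_def jidx_def)
    obtain B where "\<And>x. \<bar>pds xshift (ordering J) \<phi> x\<bar> \<le> B"
      using test_function_bounded[OF test_function_pds[OF \<phi>]] by blast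
    then have "moderate_on \<Omega> (\<lambda>_. pds xshift (ordering J) \<phi>)"
      by (rule moderate_on_bounded)
    from negligible_on_mult_moderate[OF negligible_on_add[OF 1 2] this] show ?thesis by simp
  qed
  show ?thesis
  proof (rule Lim_transform_eventually)
    show "((\<lambda>\<epsilon>. LINT x:\<Omega>|lborel. \<Sum>J | size J \<le> n. (DL J \<epsilon> x - DM J \<epsilon> x) * pds xshift (ordering J) \<phi> x) \<longlongrightarrow> 0) (at_right 0)"
      by (intro negligible_on_integral[OF \<Omega>] negligible_on_sum negl) simp
    show "\<forall>\<^sub>F \<epsilon> in at_right 0. (LINT x:\<Omega>|lborel. \<Sum>J | size J \<le> n. (DL J \<epsilon> x - DM J \<epsilon> x) * pds xshift (ordering J) \<phi> x) =
        first_variation n \<Omega> \<alpha> \<phi> (L \<epsilon>) (\<lambda>\<beta>. u \<beta> \<epsilon>) - first_variation n \<Omega> \<alpha> \<phi> (M \<epsilon>) (\<lambda>\<beta>. v \<beta> \<epsilon>)"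
      using eventually_unit_interval
    proof eventually_elim
      case (elim \<epsilon>)
      have "set_integrable lborel \<Omega> (\<lambda>x. \<Sum>J | size J \<le> n. DL J \<epsilon> x * pds xshift (ordering J) \<phi> x)"
        unfolding DL_def
        by (rule set_integrable_first_variation[OF \<Omega>(1) tempered_moderate_smooth[OF \<Omega>(1) L elim]
              moderate_family_smooth[OF u elim] \<phi>])
      moreover have "set_integrable lborel \<Omega> (\<lambda>x. \<Sum>J | size J \<le> n. DM J \<epsilon> x * pds xshift (ordering J) \<phi> x)"
        unfolding DM_def
        by (rule set_integrable_first_variation[OF \<Omega>(1) tempered_moderate_smooth[OF \<Omega>(1) M elim]
              moderate_family_smooth[OF v elim] \<phi>])
      ultimately show ?case
        unfolding first_variation_def DL_def[symmetric] DM_def[symmetric] left_diff_distrib sum_subtractf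
        by (rule set_integral_diff(2))
    qed
  qed
qed

lemma test_function_scale:
  assumes "\<phi> \<in> test_functions \<Omega>" shows "(\<lambda>x. c * \<phi> x) \<in> test_functions \<Omega>"
proof -
  interpret coordinate_space xshift UNIV "UNIV :: (real ^ 'a) set"
    by (rule coordinate_space_xshift) simp
  have K: "compact (closure {x. \<phi> x \<noteq> 0})" "closure {x. \<phi> x \<noteq> 0} \<subseteq> \<Omega>"
    using assms by (auto simp: test_functions_def)
  have sub: "closure {x. c * \<phi> x \<noteq> 0} \<subseteq> closure {x. \<phi> x \<noteq> 0}"
    by (rule closure_mono) auto
  have "compact (closure {x. c * \<phi> x \<noteq> 0})"
    using compact_Int_closed[OF K(1) closed_closure, of "{x. c * \<phi> x \<noteq> 0}"] sub
    by (simp only: Int_absorb1)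
  moreover have "smooth_on xshift UNIV UNIV (\<lambda>x. c * \<phi> x)"
    by (rule smooth_on_mult[OF smooth_on_const test_function_smooth[OF assms]])
  ultimately show ?thesis
    using order_trans[OF sub K(2)] by (simp only: test_functions_def mem_Collect_eq)
qed

section \<open>The Euler--Lagrange equations\<close>

theorem proposition3p12:
  fixes \<Omega> :: "(real ^ 'p::finite) set"
    and n :: nat
    and L :: "('p, 'q::finite) jnet set"
    and u :: "'q \<Rightarrow> 'p net set"
  assumes "open \<Omega>" and "connected \<Omega>" and "bounded \<Omega>" and "smooth_boundary \<Omega>"
    and "L \<in> tempered n \<Omega>"
    and "\<exists>L'\<in>L. \<exists>C. \<forall>\<epsilon>\<in>{0<..1}. \<forall>z\<in>closure \<Omega> \<times> UNIV. hessian_norm n \<Omega> (L' \<epsilon>) z \<le> C"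
    and "\<forall>\<alpha>. u \<alpha> \<in> colombeau \<Omega>"
    and "minimizer_assoc \<Omega> L u"
  shows "\<forall>L'\<in>L. \<forall>u'. (\<forall>\<alpha>. u' \<alpha> \<in> u \<alpha>) \<longrightarrow>
           (\<forall>\<alpha>. \<forall>\<phi>\<in>test_functions \<Omega>.
              ((\<lambda>\<epsilon>. LINT x:\<Omega>|lborel. euler n \<alpha> (L' \<epsilon>) (jet (\<lambda>\<beta>. u' \<beta> \<epsilon>) x) * \<phi> x) \<longlongrightarrow> 0)
                (at_right 0))"
proof (intro ballI allI impI)
  fix L2 u2 \<alpha> \<phi>
  assume L2: "L2 \<in> L" and u2: "\<forall>\<alpha>. u2 \<alpha> \<in> u \<alpha>" and \<phi>: "\<phi> \<in> test_functions \<Omega>"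
  note \<Omega> = assms(1,3)
  \<comment> \<open>\<open>L1\<close> has bounded Hessian, \<open>(L0, u0)\<close> is minimizing, and the claim is about \<open>(L2, u2)\<close>.
    The argument passes through \<open>(L1, u0)\<close>.\<close>
  obtain L1 C where L1: "L1 \<in> L"
    and C: "\<forall>\<epsilon>\<in>{0<..1}. \<forall>z\<in>closure \<Omega> \<times> UNIV. hessian_norm n \<Omega> (L1 \<epsilon>) z \<le> C"
    using assms(6) by (elim bexE exE)
  obtain L0 u0 where L0: "L0 \<in> L" and u0: "\<forall>\<alpha>. u0 \<alpha> \<in> u \<alpha>"
    and lim: "\<forall>\<psi>. (\<forall>\<alpha>. \<psi> \<alpha> \<in> test_functions \<Omega>) \<longrightarrow>
      (\<exists>l\<ge>0. ((\<lambda>\<epsilon>. functional \<Omega> (L0 \<epsilon>) (\<lambda>\<alpha> x. u0 \<alpha> \<epsilon> x + \<psi> \<alpha> x) -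
        functional \<Omega> (L0 \<epsilon>) (\<lambda>\<alpha>. u0 \<alpha> \<epsilon>)) \<longlongrightarrow> l) (at_right 0))"
    using assms(8) unfolding minimizer_assoc_def by (elim bexE exE conjE)
  have hess: "hessian_norm n \<Omega> (L1 \<epsilon>) z \<le> C" if "\<epsilon> \<in> {0<..1}" "z \<in> \<Omega> \<times> UNIV" for \<epsilon> z
    using C that closure_subset[of \<Omega>] by auto
  have fam: "moderate_family \<Omega> w" if "\<forall>\<alpha>. w \<alpha> \<in> u \<alpha>" for w
    by (rule moderate_family_of_moderate,
        rule colombeau_representatives(1)[OF \<Omega>(1) spec[OF assms(7)] spec[OF that] spec[OF that]])
  note m0 = fam[OF u0] and m2 = fam[OF u2]
  note K = assms(5)
  define V where "V t \<beta> \<epsilon> = (\<lambda>x. u0 \<beta> \<epsilon> x + (if \<beta> = \<alpha> then t else 0) * \<phi> x)" for t :: real and \<beta> \<epsilon>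
  define inc where "inc M t \<epsilon> = functional \<Omega> (M \<epsilon>) (\<lambda>\<beta>. V t \<beta> \<epsilon>) - functional \<Omega> (M \<epsilon>) (\<lambda>\<beta>. u0 \<beta> \<epsilon>)"
    for M :: "('p, 'q) jnet" and t \<epsilon>
  have V: "moderate_family \<Omega> (V t)" for t
    unfolding V_def[abs_def] by (rule moderate_family_translate[OF \<Omega>(1) m0 \<phi>])
  have lim1: "\<exists>l\<ge>0. (inc L1 t \<longlongrightarrow> l) (at_right 0)" for t
  proof -
    obtain l where l: "0 \<le> l" "(inc L0 t \<longlongrightarrow> l) (at_right 0)"
      using lim[rule_format, of "\<lambda>\<beta> x. (if \<beta> = \<alpha> then t else 0) * \<phi> x"] test_function_scale[OF \<phi>]
      unfolding inc_def[abs_def] V_def by blast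
    have "((\<lambda>\<epsilon>. inc L0 t \<epsilon> +
        ((functional \<Omega> (L1 \<epsilon>) (\<lambda>\<beta>. V t \<beta> \<epsilon>) - functional \<Omega> (L0 \<epsilon>) (\<lambda>\<beta>. V t \<beta> \<epsilon>)) -
         (functional \<Omega> (L1 \<epsilon>) (\<lambda>\<beta>. u0 \<beta> \<epsilon>) - functional \<Omega> (L0 \<epsilon>) (\<lambda>\<beta>. u0 \<beta> \<epsilon>)))) \<longlongrightarrow> l + (0 - 0)) (at_right 0)"
      by (intro tendsto_add tendsto_diff l(2) functional_independent_of_representative[OF \<Omega> _ K L1 L0] V m0)
    then have "(inc L1 t \<longlongrightarrow> l) (at_right 0)" by (simp add: inc_def[abs_def])
    with l(1) show ?thesis by blast
  qed
  obtain M where "0 \<le> M" "\<And>t. \<forall>\<^sub>F \<epsilon> in at_right 0.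
      \<bar>inc L1 t \<epsilon> - t * first_variation n \<Omega> \<alpha> \<phi> (L1 \<epsilon>) (\<lambda>\<beta>. u0 \<beta> \<epsilon>)\<bar> \<le> M * t\<^sup>2"
    using functional_increment_estimate[OF \<Omega> m0 tempered_representatives(1)[OF \<Omega>(1) K L1 L1] hess \<phi>]
    unfolding inc_def V_def by blast
  from first_order_condition[OF lim1 this(2,1)]
  have "((\<lambda>\<epsilon>. first_variation n \<Omega> \<alpha> \<phi> (L1 \<epsilon>) (\<lambda>\<beta>. u0 \<beta> \<epsilon>)) \<longlongrightarrow> 0) (at_right 0)" .
  moreover have "((\<lambda>\<epsilon>. first_variation n \<Omega> \<alpha> \<phi> (L1 \<epsilon>) (\<lambda>\<beta>. u0 \<beta> \<epsilon>) -
      first_variation n \<Omega> \<alpha> \<phi> (L2 \<epsilon>) (\<lambda>\<beta>. u2 \<beta> \<epsilon>)) \<longlongrightarrow> 0) (at_right 0)"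
    by (rule first_variation_independent_of_representatives[OF \<Omega> m0 m2
          colombeau_representatives(2)[OF \<Omega>(1) spec[OF assms(7)] spec[OF u0] spec[OF u2]] K L1 L2 hess \<phi>])
  ultimately have "((\<lambda>\<epsilon>. first_variation n \<Omega> \<alpha> \<phi> (L2 \<epsilon>) (\<lambda>\<beta>. u2 \<beta> \<epsilon>)) \<longlongrightarrow> 0 - 0) (at_right 0)"
    using tendsto_diff by fastforce
  moreover have "\<forall>\<^sub>F \<epsilon> in at_right 0. first_variation n \<Omega> \<alpha> \<phi> (L2 \<epsilon>) (\<lambda>\<beta>. u2 \<beta> \<epsilon>) =
      (LINT x:\<Omega>|lborel. euler n \<alpha> (L2 \<epsilon>) (jet (\<lambda>\<beta>. u2 \<beta> \<epsilon>) x) * \<phi> x)"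
    using eventually_unit_interval
  proof eventually_elim
    case (elim \<epsilon>)
    note T = tempered_representatives(1)[OF \<Omega>(1) K L2 L2]
    show ?case
      unfolding first_variation_def
      by (rule integral_euler[OF \<Omega>(1) tempered_moderate_jets(1)[OF T elim] tempered_moderate_smooth[OF \<Omega>(1) T elim]
            moderate_family_smooth[OF m2 elim] \<phi>, symmetric])
  qed
  ultimately show "((\<lambda>\<epsilon>. LINT x:\<Omega>|lborel. euler n \<alpha> (L2 \<epsilon>) (jet (\<lambda>\<beta>. u2 \<beta> \<epsilon>) x) * \<phi> x) \<longlongrightarrow> 0) (at_right 0)"
    using Lim_transform_eventually by fastforce
qed

end
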